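(* Let $(M,g_L)$ be a compact Lorentzian manifold and $U$ a timelike Killing vector field on $M$. Then $$0\leq\int_M \left(Ric_L(U,U)-\frac{2}{g_L(U,U)}\,g_L(\nabla^L_UU,\nabla^L_UU)\right)dg_L.$$
   Context: Lorentzian metrics have signature $(-,+,\dots,+)$, so $g_L(U,U)<0$ everywhere. $\nabla^L$ is the Levi-Civita connection of $g_L$, $dg_L$ its canonical volume element, and $Ric_L$ its Ricci tensor, $Ric_L(V,V)=\sum_i \epsilon_i\, g_L(R_{e_iV}V,e_i)$ for a local orthonormal frame $\{e_i\}$ with $\epsilon_i=g_L(e_i,e_i)$ and $R_{UV}W=\nabla^L_U\nabla^L_VW-\nabla^L_V\nabla^L_UW-\nabla^L_{[U,V]}W$. *)

theory Defs
  imports "HOL-Analysis.Analysis"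
begin

section \<open>Smooth maps on open sets\<close>

text \<open>These two notions are only meant for open \<open>S\<close>; there, \<open>smooth_on S f\<close> says that \<open>f\<close> is
  \<open>C\<^sup>\<infinity>\<close> on \<open>S\<close>.\<close>

fun Ck_on :: "nat \<Rightarrow> 'v::real_normed_vector set \<Rightarrow> ('v \<Rightarrow> 'w::real_normed_vector) \<Rightarrow> bool" where
  "Ck_on 0 S f \<longleftrightarrow> continuous_on S f"
| "Ck_on (Suc k) S f \<longleftrightarrow>
     (\<forall>x\<in>S. f differentiable (at x)) \<and> (\<forall>v. Ck_on k S (\<lambda>x. frechet_derivative f (at x) v))"

definition smooth_on :: "'v::real_normed_vector set \<Rightarrow> ('v \<Rightarrow> 'w::real_normed_vector) \<Rightarrow> bool" where
  "smooth_on S f \<longleftrightarrow> (\<forall>k. Ck_on k S f)"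


section \<open>Smooth manifolds of dimension \<open>CARD('n)\<close>\<close>

type_synonym ('a, 'n) chart = "'a set \<times> ('a \<Rightarrow> real ^ 'n)"

abbreviation cdom :: "('a, 'n) chart \<Rightarrow> 'a set" where "cdom c \<equiv> fst c"
abbreviation cmap :: "('a, 'n) chart \<Rightarrow> 'a \<Rightarrow> real ^ 'n" where "cmap c \<equiv> snd c"
abbreviation cimg :: "('a, 'n) chart \<Rightarrow> (real ^ 'n) set" where "cimg c \<equiv> cmap c ` cdom c"
abbreviation cinv :: "('a, 'n) chart \<Rightarrow> real ^ 'n \<Rightarrow> 'a" where "cinv c \<equiv> inv_into (cdom c) (cmap c)"

definition is_chart :: "'a topology \<Rightarrow> ('a, 'n::finite) chart \<Rightarrow> bool" where
  "is_chart M c \<longleftrightarrow> openin M (cdom c) \<and> open (cimg c) \<and>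
     homeomorphic_map (subtopology M (cdom c)) (top_of_set (cimg c)) (cmap c)"

definition transition :: "('a, 'n) chart \<Rightarrow> ('a, 'n) chart \<Rightarrow> real ^ 'n \<Rightarrow> real ^ 'n" where
  "transition c c' = cmap c' \<circ> cinv c"

definition smooth_atlas :: "'a topology \<Rightarrow> ('a, 'n::finite) chart set \<Rightarrow> bool" where
  "smooth_atlas M A \<longleftrightarrow> (\<forall>c\<in>A. is_chart M c) \<and> (\<Union>c\<in>A. cdom c) = topspace M \<and>
     (\<forall>c\<in>A. \<forall>c'\<in>A. smooth_on (cmap c ` (cdom c \<inter> cdom c')) (transition c c'))"

definition smooth_manifold :: "'a topology \<Rightarrow> ('a, 'n::finite) chart set \<Rightarrow> bool" where
  "smooth_manifold M A \<longleftrightarrow> Hausdorff_space M \<and> second_countable M \<and> smooth_atlas M A"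

definition smooth_fun :: "('a, 'n::finite) chart set \<Rightarrow> ('a \<Rightarrow> real) \<Rightarrow> bool" where
  "smooth_fun A f \<longleftrightarrow> (\<forall>c\<in>A. smooth_on (cimg c) (f \<circ> cinv c))"


section \<open>Tangent vectors and vector fields\<close>

text \<open>A tangent vector at \<open>p\<close> is the family of its component vectors in all charts around \<open>p\<close>,
  related by the derivatives of the transition maps. Setting the components to \<open>0\<close> in all other
  charts makes the representation unique, so that equality of tangent vectors and of vector fields
  is equality of functions; addition and scaling are chartwise. A vector field has the value \<open>0\<close>
  outside of \<open>M\<close>.\<close>

type_synonym ('a, 'n) tvec = "('a, 'n) chart \<Rightarrow> real ^ 'n"
type_synonym ('a, 'n) vfield = "'a \<Rightarrow> ('a, 'n) tvec"

definition charts_at :: "('a, 'n) chart set \<Rightarrow> 'a \<Rightarrow> ('a, 'n) chart set" where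
  "charts_at A p = {c \<in> A. p \<in> cdom c}"

definition tangent_space :: "('a, 'n::finite) chart set \<Rightarrow> 'a \<Rightarrow> ('a, 'n) tvec set" where
  "tangent_space A p = {v.
     (\<forall>c\<in>charts_at A p. \<forall>c'\<in>charts_at A p.
        v c' = frechet_derivative (transition c c') (at (cmap c p)) (v c)) \<and>
     (\<forall>c. c \<notin> charts_at A p \<longrightarrow> v c = 0)}"

text \<open>The tangent vector with components \<open>w\<close> in the chart \<open>c\<close>; for \<open>w = axis i 1\<close> this is the
  \<open>i\<close>-th coordinate vector of \<open>c\<close> at \<open>p\<close>.\<close>

definition tvec_of :: "('a, 'n::finite) chart set \<Rightarrow> ('a, 'n) chart \<Rightarrow> 'a \<Rightarrow> real ^ 'n \<Rightarrow> ('a, 'n) tvec" where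
  "tvec_of A c p w = (\<lambda>c'. if c' \<in> charts_at A p
     then frechet_derivative (transition c c') (at (cmap c p)) w else 0)"

definition vector_field :: "('a, 'n::finite) chart set \<Rightarrow> ('a, 'n) vfield \<Rightarrow> bool" where
  "vector_field A X \<longleftrightarrow> (\<forall>p. X p \<in> tangent_space A p) \<and>
     (\<forall>c\<in>A. smooth_on (cimg c) (\<lambda>x. X (cinv c x) c))"

definition vf_add :: "('a, 'n::finite) vfield \<Rightarrow> ('a, 'n) vfield \<Rightarrow> ('a, 'n) vfield" where
  "vf_add X Y = (\<lambda>p c. X p c + Y p c)"

definition vf_diff :: "('a, 'n::finite) vfield \<Rightarrow> ('a, 'n) vfield \<Rightarrow> ('a, 'n) vfield" where
  "vf_diff X Y = (\<lambda>p c. X p c - Y p c)"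

definition vf_scale :: "('a \<Rightarrow> real) \<Rightarrow> ('a, 'n::finite) vfield \<Rightarrow> ('a, 'n) vfield" where
  "vf_scale f X = (\<lambda>p c. f p *\<^sub>R X p c)"

text \<open>The function \<open>X f\<close>; by the chain rule, the value does not depend on the chart chosen.\<close>

definition vf_apply :: "('a, 'n::finite) chart set \<Rightarrow> ('a, 'n) vfield \<Rightarrow> ('a \<Rightarrow> real) \<Rightarrow> 'a \<Rightarrow> real" where
  "vf_apply A X f p = (let c = (SOME c. c \<in> charts_at A p)
     in frechet_derivative (f \<circ> cinv c) (at (cmap c p)) (X p c))"

definition lie_bracket :: "('a, 'n::finite) chart set \<Rightarrow> ('a, 'n) vfield \<Rightarrow> ('a, 'n) vfield \<Rightarrow> ('a, 'n) vfield" where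
  "lie_bracket A X Y = (\<lambda>p c. if c \<in> charts_at A p
     then frechet_derivative (\<lambda>x. Y (cinv c x) c) (at (cmap c p)) (X p c)
        - frechet_derivative (\<lambda>x. X (cinv c x) c) (at (cmap c p)) (Y p c)
     else 0)"


section \<open>Lorentzian metrics\<close>

type_synonym ('a, 'n) metric = "'a \<Rightarrow> ('a, 'n) tvec \<Rightarrow> ('a, 'n) tvec \<Rightarrow> real"

definition metric_matrix ::
  "('a, 'n::finite) chart set \<Rightarrow> ('a, 'n) metric \<Rightarrow> ('a, 'n) chart \<Rightarrow> real ^ 'n \<Rightarrow> real ^ 'n ^ 'n" where
  "metric_matrix A g c x = (let p = cinv c x
     in \<chi> i j. g p (tvec_of A c p (axis i 1)) (tvec_of A c p (axis j 1)))"

text \<open>As \<open>tangent_space A p\<close> has dimension \<open>CARD('n)\<close>, the orthonormal families \<open>e\<close> below are bases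
  and exhibit the signature \<open>(-,+,\<dots>,+)\<close>.\<close>

definition lorentzian_metric :: "'a topology \<Rightarrow> ('a, 'n::finite) chart set \<Rightarrow> ('a, 'n) metric \<Rightarrow> bool" where
  "lorentzian_metric M A g \<longleftrightarrow>
     (\<forall>p\<in>topspace M.
        (\<forall>v\<in>tangent_space A p. \<forall>w\<in>tangent_space A p. g p v w = g p w v) \<and>
        (\<forall>u\<in>tangent_space A p. \<forall>v\<in>tangent_space A p. \<forall>w\<in>tangent_space A p. \<forall>a b.
           g p (\<lambda>c. a *\<^sub>R u c + b *\<^sub>R v c) w = a * g p u w + b * g p v w) \<and>
        (\<exists>(e :: 'n \<Rightarrow> ('a, 'n) tvec) k. (\<forall>i. e i \<in> tangent_space A p) \<and>
           (\<forall>i j. g p (e i) (e j) = (if i \<noteq> j then 0 else if i = k then -1 else 1)))) \<and>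
     (\<forall>c\<in>A. \<forall>i j. smooth_on (cimg c) (\<lambda>x. metric_matrix A g c x $ i $ j))"

definition vf_inner :: "('a, 'n::finite) metric \<Rightarrow> ('a, 'n) vfield \<Rightarrow> ('a, 'n) vfield \<Rightarrow> 'a \<Rightarrow> real" where
  "vf_inner g X Y = (\<lambda>p. g p (X p) (Y p))"

definition timelike :: "'a topology \<Rightarrow> ('a, 'n::finite) metric \<Rightarrow> ('a, 'n) vfield \<Rightarrow> bool" where
  "timelike M g U \<longleftrightarrow> (\<forall>p\<in>topspace M. vf_inner g U U p < 0)"

text \<open>Killing: the Lie derivative of the metric along \<open>U\<close> vanishes,
  \<open>(L\<^sub>U g)(X,Y) = U (g(X,Y)) - g([U,X],Y) - g(X,[U,Y]) = 0\<close>.\<close>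

definition killing_field ::
  "'a topology \<Rightarrow> ('a, 'n::finite) chart set \<Rightarrow> ('a, 'n) metric \<Rightarrow> ('a, 'n) vfield \<Rightarrow> bool" where
  "killing_field M A g U \<longleftrightarrow> vector_field A U \<and>
     (\<forall>X Y. vector_field A X \<longrightarrow> vector_field A Y \<longrightarrow>
        (\<forall>p\<in>topspace M. vf_apply A U (vf_inner g X Y) p
            - vf_inner g (lie_bracket A U X) Y p - vf_inner g X (lie_bracket A U Y) p = 0))"


section \<open>Levi-Civita connection and curvature\<close>

definition affine_connection ::
  "('a, 'n::finite) chart set \<Rightarrow> (('a, 'n) vfield \<Rightarrow> ('a, 'n) vfield \<Rightarrow> ('a, 'n) vfield) \<Rightarrow> bool" where
  "affine_connection A nabla \<longleftrightarrow>
     (\<forall>X Y. vector_field A X \<longrightarrow> vector_field A Y \<longrightarrow> vector_field A (nabla X Y)) \<and>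
     (\<forall>X Y Z. vector_field A X \<longrightarrow> vector_field A Y \<longrightarrow> vector_field A Z \<longrightarrow>
        nabla (vf_add X Y) Z = vf_add (nabla X Z) (nabla Y Z) \<and>
        nabla X (vf_add Y Z) = vf_add (nabla X Y) (nabla X Z)) \<and>
     (\<forall>f X Y. smooth_fun A f \<longrightarrow> vector_field A X \<longrightarrow> vector_field A Y \<longrightarrow>
        nabla (vf_scale f X) Y = vf_scale f (nabla X Y) \<and>
        nabla X (vf_scale f Y) = vf_add (vf_scale (vf_apply A X f) Y) (vf_scale f (nabla X Y)))"

definition levi_civita ::
  "'a topology \<Rightarrow> ('a, 'n::finite) chart set \<Rightarrow> ('a, 'n) metric \<Rightarrow>
     (('a, 'n) vfield \<Rightarrow> ('a, 'n) vfield \<Rightarrow> ('a, 'n) vfield) \<Rightarrow> bool" where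
  "levi_civita M A g nabla \<longleftrightarrow> affine_connection A nabla \<and>
     (\<forall>X Y. vector_field A X \<longrightarrow> vector_field A Y \<longrightarrow>
        vf_diff (nabla X Y) (nabla Y X) = lie_bracket A X Y) \<and>
     (\<forall>X Y Z. vector_field A X \<longrightarrow> vector_field A Y \<longrightarrow> vector_field A Z \<longrightarrow>
        (\<forall>p\<in>topspace M. vf_apply A X (vf_inner g Y Z) p =
           vf_inner g (nabla X Y) Z p + vf_inner g Y (nabla X Z) p))"

definition curvature ::
  "('a, 'n::finite) chart set \<Rightarrow> (('a, 'n) vfield \<Rightarrow> ('a, 'n) vfield \<Rightarrow> ('a, 'n) vfield) \<Rightarrow>
     ('a, 'n) vfield \<Rightarrow> ('a, 'n) vfield \<Rightarrow> ('a, 'n) vfield \<Rightarrow> ('a, 'n) vfield" where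
  "curvature A nabla U V W =
     vf_diff (vf_diff (nabla U (nabla V W)) (nabla V (nabla U W))) (nabla (lie_bracket A U V) W)"

text \<open>Connections act on globally defined vector fields. So a local orthonormal frame around \<open>p\<close> is
  given by global vector fields that are orthonormal on some neighbourhood of \<open>p\<close>; shrinking the
  neighbourhood and multiplying by a bump function, every local frame arises in this way.\<close>

definition orthonormal_frame_around ::
  "'a topology \<Rightarrow> ('a, 'n::finite) chart set \<Rightarrow> ('a, 'n) metric \<Rightarrow> 'a \<Rightarrow> ('n \<Rightarrow> ('a, 'n) vfield) \<Rightarrow> bool" where
  "orthonormal_frame_around M A g p E \<longleftrightarrow> (\<forall>i. vector_field A (E i)) \<and>
     (\<exists>W. openin M W \<and> p \<in> W \<and>
        (\<forall>q\<in>W. \<forall>i j. if i = j then \<bar>vf_inner g (E i) (E j) q\<bar> = 1 else vf_inner g (E i) (E j) q = 0))"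

text \<open>\<open>Ric(V,V)\<close> at \<open>p\<close>; the curvature being tensorial, it does not depend on the frame chosen.\<close>

definition ricci ::
  "'a topology \<Rightarrow> ('a, 'n::finite) chart set \<Rightarrow> ('a, 'n) metric \<Rightarrow>
     (('a, 'n) vfield \<Rightarrow> ('a, 'n) vfield \<Rightarrow> ('a, 'n) vfield) \<Rightarrow> ('a, 'n) vfield \<Rightarrow> 'a \<Rightarrow> real" where
  "ricci M A g nabla V p = (let E = (SOME E. orthonormal_frame_around M A g p E)
     in \<Sum>i\<in>UNIV. vf_inner g (E i) (E i) p * vf_inner g (curvature A nabla (E i) V V) (E i) p)"


section \<open>The canonical volume element\<close>

text \<open>The Borel measure on \<open>M\<close> given by the density \<open>\<surd>\<bar>det (g\<^sub>i\<^sub>j)\<bar> dx\<^sub>1 \<dots> dx\<^sub>n\<close> in every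
  chart (no orientation is needed).\<close>

definition volume_measure ::
  "'a topology \<Rightarrow> ('a, 'n::finite) chart set \<Rightarrow> ('a, 'n) metric \<Rightarrow> 'a measure \<Rightarrow> bool" where
  "volume_measure M A g \<mu> \<longleftrightarrow>
     space \<mu> = topspace M \<and> sets \<mu> = sigma_sets (topspace M) {W. openin M W} \<and>
     (\<forall>c\<in>A. \<forall>B\<in>sets \<mu>. B \<subseteq> cdom c \<longrightarrow>
        emeasure \<mu> B =
          (\<integral>\<^sup>+x\<in>cmap c ` B. ennreal (sqrt \<bar>det (metric_matrix A g c x)\<bar>) \<partial>lborel))"

end

theory Submission
  imports Defs
begin

text \<open>
  Put \<open>Z = \<nabla>\<^sub>U U\<close>. As \<open>U\<close> is Killing, the form \<open>F(X,Y) = g(\<nabla>\<^sub>X U, Y)\<close> is skew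
  (\<open>nabla_killing_skew\<close>). In particular \<open>g(\<nabla>\<^sub>E U, E)\<close> vanishes for every vector field \<open>E\<close>;
  differentiating this along \<open>U\<close> gives, with no choice of coordinates or frame,
  \<open>g(R(E,U)U, E) = g(\<nabla>\<^sub>E Z, E) + g(\<nabla>\<^sub>E U, \<nabla>\<^sub>E U)\<close> (\<open>inner_curvature_killing\<close>). Summing over
  an orthonormal frame with signs \<open>\<epsilon>\<^sub>i\<close> gives \<open>Ric(U,U) = div Z + N\<close>, where
  \<open>N = \<Sum>\<^sub>i \<epsilon>\<^sub>i g(\<nabla>\<^sub>E\<^sub>i U, \<nabla>\<^sub>E\<^sub>i U) = \<Sum>\<^sub>i\<^sub>j \<epsilon>\<^sub>i \<epsilon>\<^sub>j F(E\<^sub>i,E\<^sub>j)\<^sup>2\<close> (\<open>ricci_killing\<close>).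

  The number \<open>N\<close> does not depend on the orthonormal basis of the tangent space. In a basis \<open>f\<close>
  whose timelike member is \<open>U\<close> up to a factor, the terms of \<open>N\<close> with a negative sign are those
  with exactly one timelike index, and they add up to \<open>2 g(Z,Z) / g(U,U)\<close>, as \<open>g(Z,f\<^sub>j) = F(U,f\<^sub>j)\<close>.
  All other terms are squares. So \<open>N \<ge> 2 g(Z,Z) / g(U,U)\<close>
  (\<open>lorentzian_skew_form_inequality\<close>, \<open>sum_inner_nabla_killing_ge\<close>): the integrand of the theorem
  is bounded below by \<open>div Z\<close>.

  It remains to see that the integral of a divergence vanishes (\<open>integral_divergence_eq_0\<close>). For
  vector fields \<open>E\<close> and \<open>Y\<close>, compatibility with the metric and vanishing torsion express
  \<open>g(\<nabla>\<^sub>E Y, E)\<close> in a chart by the first derivatives of \<open>Y\<close> and of the matrix \<open>G\<close> of the metric,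
  without any derivative of \<open>E\<close> (\<open>inner_nabla_self_chart\<close>). Summing over a frame and using
  Jacobi's formula for the derivative of the determinant gives the familiar
  \<open>\<surd>\<bar>det G\<bar> div Y = \<Sum>\<^sub>k \<partial>\<^sub>k (\<surd>\<bar>det G\<bar> Y\<^sup>k)\<close> (\<open>divergence_chart\<close>). If \<open>Y\<close> has compact support in
  a chart, each term on the right has integral \<open>0\<close>, since the Lebesgue measure is invariant under
  translations (\<open>integral_directional_derivative_eq_0\<close>). A general \<open>Y\<close> on the compact manifold is
  a finite sum of such fields.

  If the integrand is not integrable, its Bochner integral is \<open>0\<close> and the claim is trivial; otherwise
  the integral is at least that of \<open>div Z\<close>, which is \<open>0\<close>.
\<close>


section \<open>Calculus of smooth maps on open sets\<close>

lemma Ck_on_cong_imp: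
  assumes "open S" "\<And>x. x \<in> S \<Longrightarrow> f x = g x" "Ck_on k S f"
  shows "Ck_on k S g"
  using assms(2,3)
proof (induction k arbitrary: f g)
  case 0
  then show ?case by (simp cong: continuous_on_cong)
next
  case (Suc k)
  have d: "(g has_derivative frechet_derivative f (at x)) (at x)" if "x \<in> S" for x
  proof (rule has_derivative_transform_within_open[OF _ assms(1) that])
    show "(f has_derivative frechet_derivative f (at x)) (at x)"
      using Suc.prems(2) that by (simp add: frechet_derivative_works)
  qed (use Suc.prems(1) in auto)
  have eq: "frechet_derivative f (at x) = frechet_derivative g (at x)" if "x \<in> S" for x
    using d[OF that] frechet_derivative_at by blast
  show ?case
    using Suc.prems(2) Suc.IH[of "\<lambda>x. frechet_derivative f (at x) v" "\<lambda>x. frechet_derivative g (at x) v" for v] d eq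
    by (auto simp: differentiable_def)
qed

lemma Ck_on_SucD:
  assumes "Ck_on (Suc k) S f" "x \<in> S"
  shows "(f has_derivative frechet_derivative f (at x)) (at x)"
  using assms by (auto simp: frechet_derivative_works)

text \<open>The definition of \<open>Ck_on\<close> refers to \<open>frechet_derivative\<close>; this rule admits a derivative given
  in any other form, as the rules of differentiation produce it.\<close>

lemma Ck_on_SucI:
  assumes "open S" "\<And>x. x \<in> S \<Longrightarrow> (f has_derivative f' x) (at x)"
    "\<And>v. Ck_on k S (\<lambda>x. f' x v)"
  shows "Ck_on (Suc k) S f"
proof -
  have eq: "f' x = frechet_derivative f (at x)" if "x \<in> S" for x
    using assms(2)[OF that] frechet_derivative_at by blast
  show ?thesis
    using assms(2) Ck_on_cong_imp[OF assms(1) _ assms(3)] eq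
    by (auto simp: differentiable_def)
qed

lemma Ck_on_Suc_imp: "Ck_on (Suc k) S f \<Longrightarrow> Ck_on k S f"
proof (induction k arbitrary: f)
  case 0
  then show ?case
    by (auto intro!: continuous_at_imp_continuous_on differentiable_imp_continuous_within)
next
  case (Suc k)
  from Suc.prems have a: "\<forall>x\<in>S. f differentiable at x"
    and b: "\<And>v. Ck_on (Suc k) S (\<lambda>x. frechet_derivative f (at x) v)"
    unfolding Ck_on.simps(2)[of "Suc k" S f] by auto
  from Suc.IH[OF b] a show ?case by auto
qed

lemma Ck_on_subset: "Ck_on k S f \<Longrightarrow> T \<subseteq> S \<Longrightarrow> Ck_on k T f"
  by (induction k arbitrary: f) (auto intro: continuous_on_subset)

lemma Ck_on_const: "open S \<Longrightarrow> Ck_on k S (\<lambda>x. c)"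
proof (induction k arbitrary: c)
  case (Suc k)
  show ?case by (rule Ck_on_SucI[where f'="\<lambda>_ _. 0"]) (use Suc in auto)
qed auto

lemma Ck_on_bounded_linear:
  assumes "bounded_linear L" "open S" "Ck_on k S f"
  shows "Ck_on k S (\<lambda>x. L (f x))"
  using assms(3)
proof (induction k arbitrary: f)
  case 0
  then show ?case using assms(1) by (auto intro: bounded_linear.continuous_on)
next
  case (Suc k)
  show ?case
  proof (rule Ck_on_SucI[OF assms(2)])
    show "((\<lambda>x. L (f x)) has_derivative (\<lambda>v. L (frechet_derivative f (at x) v))) (at x)" if "x \<in> S" for x
      using bounded_linear.has_derivative[OF assms(1) Ck_on_SucD[OF Suc.prems that]] .
  qed (use Suc in auto)
qed

lemma Ck_on_id: "open S \<Longrightarrow> Ck_on k S (\<lambda>x. x)"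
  by (cases k) (auto intro!: Ck_on_SucI[where f'="\<lambda>_ v. v"] Ck_on_const)

lemma Ck_on_add:
  assumes "open S" "Ck_on k S f" "Ck_on k S g"
  shows "Ck_on k S (\<lambda>x. f x + g x)"
  using assms(2,3)
proof (induction k arbitrary: f g)
  case 0
  then show ?case by (auto intro: continuous_intros)
next
  case (Suc k)
  show ?case
    by (rule Ck_on_SucI[OF assms(1) has_derivative_add[OF Ck_on_SucD[OF Suc.prems(1)] Ck_on_SucD[OF Suc.prems(2)]]])
       (use Suc in auto)
qed

lemma Ck_on_sum:
  assumes "open S" "\<And>i. i \<in> I \<Longrightarrow> Ck_on k S (f i)"
  shows "Ck_on k S (\<lambda>x. \<Sum>i\<in>I. f i x)"
  using assms(2) by (induction I rule: infinite_finite_induct)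
    (auto intro!: Ck_on_add assms(1) Ck_on_const)

lemma (in bounded_bilinear) Ck_on_prod:
  fixes S :: "'v::real_normed_vector set"
  assumes "open S" "Ck_on k S f" "Ck_on k S g"
  shows "Ck_on k S (\<lambda>x. prod (f x) (g x))"
  using assms(2,3)
proof (induction k arbitrary: f g)
  case 0
  then show ?case by (auto intro: continuous_on)
next
  case (Suc k)
  show ?case
  proof (rule Ck_on_SucI[OF assms(1) FDERIV[OF Ck_on_SucD[OF Suc.prems(1)] Ck_on_SucD[OF Suc.prems(2)]]])
    show "Ck_on k S (\<lambda>x. prod (f x) (frechet_derivative g (at x) v) + prod (frechet_derivative f (at x) v) (g x))" for v
      using Suc.prems by (intro Ck_on_add assms(1) Suc.IH) (auto intro: Ck_on_Suc_imp)
  qed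
qed

text \<open>In a basis of the middle space, the derivative of the composition is the sum of the products of
  the components of \<open>T'\<close> with the partial derivatives of \<open>f\<close> composed with \<open>T\<close>. The latter are
  again compositions, with one degree of differentiability less, so that induction applies.\<close>

lemma Ck_on_compose:
  fixes f :: "'b::euclidean_space \<Rightarrow> 'c::real_normed_vector" and T :: "'v::real_normed_vector \<Rightarrow> 'b"
  assumes "open S" "open R" "T ` S \<subseteq> R" "Ck_on k R f" "Ck_on k S T"
  shows "Ck_on k S (\<lambda>x. f (T x))"
  using assms(4,5)
proof (induction k arbitrary: f)
  case 0
  then show ?case using continuous_on_compose2 assms(3) by auto
next
  case (Suc k)
  let ?D = "\<lambda>x v. frechet_derivative f (at (T x)) (frechet_derivative T (at x) v)"
  have dT: "(T has_derivative frechet_derivative T (at x)) (at x)" if "x \<in> S" for x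
    using Ck_on_SucD[OF Suc.prems(2) that] .
  have df: "(f has_derivative frechet_derivative f (at (T x))) (at (T x))" if "x \<in> S" for x
    using Ck_on_SucD[OF Suc.prems(1)] that assms(3) by blast
  show ?case
  proof (rule Ck_on_SucI[OF assms(1)])
    show "((\<lambda>x. f (T x)) has_derivative ?D x) (at x)" if "x \<in> S" for x
      using diff_chain_at[OF dT df] that by (simp add: o_def)
    fix v
    have "Ck_on k S (\<lambda>x. \<Sum>b\<in>Basis. (frechet_derivative T (at x) v \<bullet> b) *\<^sub>R frechet_derivative f (at (T x)) b)"
    proof (intro Ck_on_sum bounded_bilinear.Ck_on_prod[OF bounded_bilinear_scaleR] assms(1))
      fix b :: 'b
      show "Ck_on k S (\<lambda>x. frechet_derivative T (at x) v \<bullet> b)"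
        using Suc.prems by (intro Ck_on_bounded_linear[OF bounded_linear_inner_left] assms(1)) auto
      show "Ck_on k S (\<lambda>x. frechet_derivative f (at (T x)) b)"
      proof (rule Suc.IH)
        show "Ck_on k R (\<lambda>y. frechet_derivative f (at y) b)" using Suc.prems(1) by simp
        show "Ck_on k S T" by (rule Ck_on_Suc_imp[OF Suc.prems(2)])
      qed
    qed
    moreover have "(\<Sum>b\<in>Basis. (frechet_derivative T (at x) v \<bullet> b) *\<^sub>R frechet_derivative f (at (T x)) b) = ?D x v"
      if "x \<in> S" for x
    proof -
      interpret bounded_linear "frechet_derivative f (at (T x))"
        using df[OF that] by (rule has_derivative_bounded_linear)
      have "?D x v = frechet_derivative f (at (T x)) (\<Sum>b\<in>Basis. (frechet_derivative T (at x) v \<bullet> b) *\<^sub>R b)"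
        by (simp add: euclidean_representation)
      then show ?thesis by (simp add: sum scaleR)
    qed
    ultimately show "Ck_on k S (\<lambda>x. ?D x v)"
      by (rule Ck_on_cong_imp[OF assms(1), rotated])
  qed
qed

lemma Ck_on_local:
  assumes "\<And>x. x \<in> S \<Longrightarrow> \<exists>T. open T \<and> x \<in> T \<and> Ck_on k T f"
  shows "Ck_on k S f"
  using assms
proof (induction k arbitrary: f)
  case 0
  show ?case unfolding Ck_on.simps
  proof (rule continuous_at_imp_continuous_on, rule ballI)
    fix x assume "x \<in> S"
    then show "isCont f x" using 0[of x] by (auto simp: continuous_on_eq_continuous_at)
  qed
next
  case (Suc k)
  show ?case
  proof (unfold Ck_on.simps, intro conjI allI ballI)
    show "f differentiable at x" if "x \<in> S" for x
      using Suc.prems[OF that] by auto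
    show "Ck_on k S (\<lambda>x. frechet_derivative f (at x) v)" for v
      by (rule Suc.IH) (use Suc.prems in fastforce)
  qed
qed

lemma smooth_on_cong_imp:
  "open S \<Longrightarrow> (\<And>x. x \<in> S \<Longrightarrow> f x = g x) \<Longrightarrow> smooth_on S f \<Longrightarrow> smooth_on S g"
  unfolding smooth_on_def using Ck_on_cong_imp by blast

lemma smooth_on_has_derivative:
  "smooth_on S f \<Longrightarrow> x \<in> S \<Longrightarrow> (f has_derivative frechet_derivative f (at x)) (at x)"
  unfolding smooth_on_def by (rule Ck_on_SucD[of 0]) auto

lemma smooth_on_frechet_derivative:
  "smooth_on S f \<Longrightarrow> smooth_on S (\<lambda>x. frechet_derivative f (at x) v)"
  unfolding smooth_on_def by (metis Ck_on.simps(2))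

lemma smooth_on_imp_continuous_on: "smooth_on S f \<Longrightarrow> continuous_on S f"
  unfolding smooth_on_def by (metis Ck_on.simps(1))

lemma smooth_on_subset: "smooth_on S f \<Longrightarrow> T \<subseteq> S \<Longrightarrow> smooth_on T f"
  unfolding smooth_on_def using Ck_on_subset by blast

lemma smooth_on_const: "open S \<Longrightarrow> smooth_on S (\<lambda>x. c)"
  unfolding smooth_on_def using Ck_on_const by blast

lemma smooth_on_id: "open S \<Longrightarrow> smooth_on S (\<lambda>x. x)"
  unfolding smooth_on_def using Ck_on_id by blast

lemma smooth_on_bounded_linear:
  "bounded_linear L \<Longrightarrow> open S \<Longrightarrow> smooth_on S f \<Longrightarrow> smooth_on S (\<lambda>x. L (f x))"
  unfolding smooth_on_def using Ck_on_bounded_linear by blast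

lemma smooth_on_add:
  "open S \<Longrightarrow> smooth_on S f \<Longrightarrow> smooth_on S g \<Longrightarrow> smooth_on S (\<lambda>x. f x + g x)"
  unfolding smooth_on_def using Ck_on_add by blast

lemma smooth_on_sum:
  "open S \<Longrightarrow> (\<And>i. i \<in> I \<Longrightarrow> smooth_on S (f i)) \<Longrightarrow> smooth_on S (\<lambda>x. \<Sum>i\<in>I. f i x)"
  by (simp add: smooth_on_def Ck_on_sum)

lemma (in bounded_bilinear) smooth_on_prod:
  "open S \<Longrightarrow> smooth_on S f \<Longrightarrow> smooth_on S g \<Longrightarrow> smooth_on S (\<lambda>x. prod (f x) (g x))"
  unfolding smooth_on_def using Ck_on_prod by blast

lemmas smooth_on_scaleR = bounded_bilinear.smooth_on_prod[OF bounded_bilinear_scaleR]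
lemmas smooth_on_mult = bounded_bilinear.smooth_on_prod[OF bounded_bilinear_mult]
lemmas smooth_on_inner = bounded_bilinear.smooth_on_prod[OF bounded_bilinear_inner]
lemmas smooth_on_vec_nth = smooth_on_bounded_linear[OF bounded_linear_vec_nth]

lemma smooth_on_diff:
  assumes "open S" "smooth_on S f" "smooth_on S g"
  shows "smooth_on S (\<lambda>x. f x - g x)"
  using smooth_on_add[OF assms(1,2) smooth_on_bounded_linear[OF bounded_linear_minus[OF bounded_linear_ident] assms(1,3)]]
  by simp

lemma smooth_on_prod_fun:
  fixes f :: "'i \<Rightarrow> 'v::real_normed_vector \<Rightarrow> real"
  shows "open S \<Longrightarrow> (\<And>i. i \<in> I \<Longrightarrow> smooth_on S (f i)) \<Longrightarrow> smooth_on S (\<lambda>x. \<Prod>i\<in>I. f i x)"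
  by (induction I rule: infinite_finite_induct) (auto intro!: smooth_on_mult smooth_on_const)

lemma smooth_on_vec:
  fixes f :: "'v::real_normed_vector \<Rightarrow> 'c::euclidean_space ^ 'n::finite"
  assumes "open S" "\<And>i. smooth_on S (\<lambda>x. f x $ i)"
  shows "smooth_on S f"
proof (rule smooth_on_cong_imp[OF assms(1)])
  show "smooth_on S (\<lambda>x. \<Sum>b\<in>Basis. \<Sum>i\<in>UNIV. (f x $ i \<bullet> b) *\<^sub>R axis i b)"
    by (intro smooth_on_sum smooth_on_scaleR smooth_on_const assms(1)
        smooth_on_bounded_linear[OF bounded_linear_inner_left] assms(2))
  show "(\<Sum>b\<in>Basis. \<Sum>i\<in>UNIV. (f x $ i \<bullet> b) *\<^sub>R axis i b) = f x" for x
    by (subst vec_eq_iff)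
      (simp add: axis_def if_distrib[of "\<lambda>x. _ *\<^sub>R x"] euclidean_representation cong: if_cong)
qed

lemma smooth_on_compose:
  fixes f :: "'b::euclidean_space \<Rightarrow> 'c::real_normed_vector" and T :: "'v::real_normed_vector \<Rightarrow> 'b"
  shows "open S \<Longrightarrow> open R \<Longrightarrow> T ` S \<subseteq> R \<Longrightarrow> smooth_on R f \<Longrightarrow> smooth_on S T
    \<Longrightarrow> smooth_on S (\<lambda>x. f (T x))"
  unfolding smooth_on_def using Ck_on_compose by blast

lemma smooth_on_local:
  "(\<And>x. x \<in> S \<Longrightarrow> \<exists>T. open T \<and> x \<in> T \<and> smooth_on T f) \<Longrightarrow> smooth_on S f"
  unfolding smooth_on_def by (intro allI Ck_on_local) meson

text \<open>Differentiation only changes the exponent and produces a constant factor. The real powers include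
  the reciprocal and all roots and inverse roots.\<close>

lemma Ck_on_powr: "Ck_on k {0<..} (\<lambda>t::real. t powr a)"
proof (induction k arbitrary: a)
  case 0
  then show ?case by (auto intro!: continuous_intros)
next
  case (Suc k)
  show ?case
  proof (rule Ck_on_SucI)
    show "((\<lambda>t. t powr a) has_derivative (\<lambda>v. a * t powr (a - 1) * v)) (at t)" if "t \<in> {0<..}" for t
      using that has_real_derivative_powr[of t a] by (auto simp: has_field_derivative_def)
    show "Ck_on k {0<..} (\<lambda>t. a * t powr (a - 1) * v)" for v
      by (intro bounded_bilinear.Ck_on_prod[OF bounded_bilinear_mult] Suc Ck_on_const) auto
  qed auto
qed

lemma smooth_on_powr:
  fixes f :: "'v::real_normed_vector \<Rightarrow> real"
  assumes "open S" "smooth_on S f" "\<And>x. x \<in> S \<Longrightarrow> f x > 0"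
  shows "smooth_on S (\<lambda>x. f x powr a)"
  by (rule smooth_on_compose[of S "{0<..}" f "\<lambda>t. t powr a"])
     (use assms Ck_on_powr in \<open>auto simp: smooth_on_def\<close>)

section \<open>Bump functions\<close>

text \<open>For \<open>p = 1\<close> this is the classical smooth function that vanishes on the negative half line without
  being zero. The factor \<open>p\<close> makes the family closed under differentiation.\<close>

definition flat :: "real poly \<Rightarrow> real \<Rightarrow> real" where
  "flat p t = (if t > 0 then poly p (1 / t) * exp (- (1 / t)) else 0)"

lemma poly_times_exp_minus_tendsto_0:
  fixes p :: "real poly"
  shows "((\<lambda>s. poly p s * exp (- s)) \<longlongrightarrow> 0) at_top"
proof -
  have "((\<lambda>s. \<Sum>i\<le>degree p. coeff p i * (s ^ i / exp s)) \<longlongrightarrow> (\<Sum>i\<le>degree p. coeff p i * 0)) at_top"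
    by (intro tendsto_intros tendsto_power_div_exp_0)
  moreover have "(\<Sum>i\<le>degree p. coeff p i * (s ^ i / exp s)) = poly p s * exp (- s)" for s
    by (simp add: poly_altdef exp_minus sum_distrib_right divide_inverse mult.assoc)
  ultimately show ?thesis by simp
qed

text \<open>Away from \<open>0\<close> this is the product rule in the variable \<open>1/t\<close>. At \<open>0\<close>, the difference quotient
  from the right is again a polynomial in \<open>1/t\<close> times \<open>exp (- 1/t)\<close>, and tends to \<open>0\<close>.\<close>

lemma flat_has_real_derivative:
  "(flat p has_real_derivative flat ([:0, 0, 1:] * (p - pderiv p)) t) (at t)"
proof -
  consider "t > 0" | "t < 0" | "t = 0" by linarith
  then show ?thesis
  proof cases
    case 1
    have "((\<lambda>t. poly p (1 / t) * exp (- (1 / t))) has_real_derivative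
        flat ([:0, 0, 1:] * (p - pderiv p)) t) (at t)"
      using 1 by (auto intro!: derivative_eq_intros DERIV_chain'[OF _ poly_DERIV]
          simp: flat_def field_simps power2_eq_square)
    then show ?thesis
      by (rule has_field_derivative_transform_within_open[where S="{0<..}"]) (use 1 in \<open>auto simp: flat_def\<close>)
  next
    case 2
    have "((\<lambda>t. 0) has_real_derivative flat ([:0, 0, 1:] * (p - pderiv p)) t) (at t)"
      using 2 by (simp add: flat_def)
    then show ?thesis
      by (rule has_field_derivative_transform_within_open[where S="{..<0}"]) (use 2 in \<open>auto simp: flat_def\<close>)
  next
    case 3
    have r: "((\<lambda>h. flat p h / h) \<longlongrightarrow> 0) (at_right 0)"
    proof -
      have "((\<lambda>h::real. poly (pCons 0 p) (inverse h) * exp (- inverse h)) \<longlongrightarrow> 0) (at_right 0)"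
        by (rule filterlim_compose[OF poly_times_exp_minus_tendsto_0 filterlim_inverse_at_top_right])
      then show ?thesis
        by (rule Lim_transform_eventually)
           (auto simp: eventually_at_filter flat_def field_simps)
    qed
    have l: "((\<lambda>h. flat p h / h) \<longlongrightarrow> 0) (at_left 0)"
      by (rule Lim_transform_eventually[OF tendsto_const]) (auto simp: eventually_at_filter flat_def)
    have "((\<lambda>h. (flat p (0 + h) - flat p 0) / h) \<longlongrightarrow> 0) (at 0)"
      using filterlim_split_at[OF l r] by (simp add: flat_def)
    then show ?thesis using 3 by (simp add: DERIV_def flat_def)
  qed
qed

lemma smooth_on_flat: "smooth_on UNIV (flat p)"
proof -
  have "Ck_on k UNIV (flat p)" for k
  proof (induction k arbitrary: p)
    case 0
    then show ?case
      by (auto intro!: continuous_at_imp_continuous_on DERIV_isCont flat_has_real_derivative)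
  next
    case (Suc k)
    show ?case
    proof (rule Ck_on_SucI)
      show "(flat p has_derivative (\<lambda>v. flat ([:0, 0, 1:] * (p - pderiv p)) t * v)) (at t)" for t
        using flat_has_real_derivative[of p t] by (simp add: has_field_derivative_def)
      show "Ck_on k UNIV (\<lambda>t. flat ([:0, 0, 1:] * (p - pderiv p)) t * v)" for v
        by (intro bounded_bilinear.Ck_on_prod[OF bounded_bilinear_mult] Suc Ck_on_const) auto
    qed auto
  qed
  then show ?thesis by (simp add: smooth_on_def)
qed

text \<open>The second factor is a reciprocal: its base is positive, as \<open>t\<close> and \<open>1 - t\<close> are never both
  nonpositive.\<close>

definition smooth_step :: "real \<Rightarrow> real" where
  "smooth_step t = flat 1 t * (flat 1 t + flat 1 (1 - t)) powr (-1)"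

lemma smooth_step_eq: "t \<le> 0 \<Longrightarrow> smooth_step t = 0" "t \<ge> 1 \<Longrightarrow> smooth_step t = 1"
  by (auto simp: smooth_step_def flat_def powr_minus)

lemma smooth_on_smooth_step: "smooth_on UNIV smooth_step"
proof -
  have "smooth_on UNIV (\<lambda>t. flat 1 (1 - t))"
    by (rule smooth_on_compose[of UNIV UNIV "\<lambda>t. 1 - t" "flat 1"])
      (auto intro!: smooth_on_flat smooth_on_diff smooth_on_const smooth_on_id)
  moreover have "flat 1 t + flat 1 (1 - t) > 0" for t
    by (auto simp: flat_def intro: add_pos_pos)
  ultimately show ?thesis
    unfolding smooth_step_def
    by (intro smooth_on_mult smooth_on_powr smooth_on_add smooth_on_flat) auto
qed

lemma bump_function_exists:
  fixes x :: "'b::euclidean_space"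
  assumes "open S" "x \<in> S"
  obtains \<beta> :: "'b \<Rightarrow> real" and r K where "smooth_on UNIV \<beta>" "r > 0" "compact K" "K \<subseteq> S"
    "ball x r \<subseteq> K" "\<And>y. y \<in> ball x r \<Longrightarrow> \<beta> y = 1" "\<And>y. y \<notin> K \<Longrightarrow> \<beta> y = 0"
proof -
  obtain R where R: "R > 0" "cball x R \<subseteq> S"
    using assms open_contains_cball by blast
  \<comment> \<open>the argument is \<open>1\<close> at distance \<open>R/2\<close> from \<open>x\<close> and \<open>0\<close> at distance \<open>R\<close>\<close>
  define \<beta> where "\<beta> y = smooth_step ((R\<^sup>2 - (y - x) \<bullet> (y - x)) * (4 / (3 * R\<^sup>2)))" for y
  have sm: "smooth_on UNIV \<beta>"
    unfolding \<beta>_def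
    by (rule smooth_on_compose[of UNIV UNIV _ smooth_step])
       (intro open_UNIV subset_UNIV smooth_on_smooth_step smooth_on_mult smooth_on_diff
          smooth_on_inner smooth_on_const smooth_on_id)+
  have one: "\<beta> y = 1" if "y \<in> ball x (R / 2)" for y
  proof -
    have "(y - x) \<bullet> (y - x) \<le> (R / 2)\<^sup>2"
      using that R by (simp add: dot_square_norm dist_norm norm_minus_commute)
    then show ?thesis
      using R unfolding \<beta>_def by (intro smooth_step_eq) (simp add: field_simps)
  qed
  have zero: "\<beta> y = 0" if "y \<notin> cball x R" for y
  proof -
    have "(y - x) \<bullet> (y - x) \<ge> R\<^sup>2"
      using that R by (simp add: dot_square_norm dist_norm norm_minus_commute)
    then show ?thesis
      unfolding \<beta>_def by (intro smooth_step_eq mult_nonpos_nonneg) auto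
  qed
  show thesis
    by (rule that[of \<beta> "R / 2" "cball x R"]) (use sm one zero R in auto)
qed

section \<open>Orthonormal families of an indefinite inner product\<close>

text \<open>The signs \<open>\<epsilon> i\<close> are arbitrary; for the metric of signature \<open>(-,+,\<dots>,+)\<close> exactly one of them is
  \<open>-1\<close>, but most of the algebra below is independent of the signature.\<close>

definition orthonormal_family :: "real ^ 'n ^ 'n \<Rightarrow> ('n::finite \<Rightarrow> real ^ 'n) \<Rightarrow> ('n \<Rightarrow> real) \<Rightarrow> bool" where
  "orthonormal_family G e \<epsilon> \<longleftrightarrow> (\<forall>i. \<bar>\<epsilon> i\<bar> = 1) \<and>
     (\<forall>i j. e i \<bullet> (G *v e j) = (if i = j then \<epsilon> i else 0))"

text \<open>The matrix \<open>P D P\<^sup>T\<close>, where \<open>P\<close> has the columns \<open>e i\<close> and \<open>D\<close> is the diagonal matrix of the signs.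
  Being the inverse of \<open>G\<close> for every orthonormal family of \<open>G\<close>, it is the tool for showing that
  signed sums over an orthonormal family do not depend on the family.\<close>

definition inverse_gram :: "('n::finite \<Rightarrow> real ^ 'n) \<Rightarrow> ('n \<Rightarrow> real) \<Rightarrow> real ^ 'n ^ 'n" where
  "inverse_gram e \<epsilon> = (\<chi> k l. \<Sum>i\<in>UNIV. \<epsilon> i * e i $ k * e i $ l)"

lemma symmetric_matrix_inner:
  fixes G :: "real ^ 'n ^ 'n"
  shows "transpose G = G \<Longrightarrow> v \<bullet> (G *v w) = w \<bullet> (G *v v)"
  by (metis dot_lmul_matrix inner_commute vector_transpose_matrix)

text \<open>Orthonormality reads \<open>P\<^sup>T G P = D\<close>. As \<open>D\<^sup>2 = 1\<close>, this says that \<open>D P\<^sup>T G\<close> is a left inverse of the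
  square matrix \<open>P\<close>. So it is a right inverse as well, and \<open>(P D P\<^sup>T) G = 1\<close>.\<close>

lemma inverse_gram_inverse:
  fixes G :: "real ^ 'n ^ 'n"
  assumes "orthonormal_family G e \<epsilon>"
  shows "inverse_gram e \<epsilon> ** G = mat 1" "G ** inverse_gram e \<epsilon> = mat 1"
proof -
  define P :: "real ^ 'n ^ 'n" where "P = (\<chi> k i. e i $ k)"
  have P_nth: "P $ k $ i = e i $ k" for k i by (simp add: P_def)
  define D :: "real ^ 'n ^ 'n" where "D = (\<chi> i j. if i = j then \<epsilon> i else 0)"
  have PGP: "transpose P ** (G ** P) = D"
  proof -
    have "(transpose P ** (G ** P)) $ i $ j = e i \<bullet> (G *v e j)" for i j
      by (simp add: matrix_matrix_mult_def matrix_vector_mult_def transpose_def P_def inner_vec_def)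
    then show ?thesis
      using assms by (simp add: vec_eq_iff orthonormal_family_def D_def)
  qed
  have "\<epsilon> i * \<epsilon> i = 1" for i
    using assms by (auto simp: orthonormal_family_def abs_if split: if_splits) (metis minus_mult_minus mult_1 minus_minus)+
  then have "D ** D = mat 1"
    by (simp add: vec_eq_iff matrix_matrix_mult_def D_def mat_def if_distrib[of "\<lambda>x. _ * x"] cong: if_cong)
  then have "(D ** (transpose P ** G)) ** P = mat 1"
    using PGP by (metis matrix_mul_assoc)
  then have "P ** (D ** (transpose P ** G)) = mat 1"
    by (simp add: matrix_left_right_inverse)
  moreover have "(D ** transpose P) $ i $ l = \<epsilon> i * e i $ l" for i l
    by (simp add: matrix_matrix_mult_def P_def D_def transpose_def if_distrib[of "\<lambda>x. x * _"] cong: if_cong)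
  then have "P ** (D ** transpose P) = inverse_gram e \<epsilon>"
    unfolding vec_eq_iff matrix_matrix_mult_def[of P "D ** transpose P"]
    by (simp add: P_nth inverse_gram_def ac_simps)
  ultimately show "inverse_gram e \<epsilon> ** G = mat 1"
    by (metis matrix_mul_assoc)
  then show "G ** inverse_gram e \<epsilon> = mat 1"
    by (simp add: matrix_left_right_inverse)
qed

lemma inverse_gram_unique:
  assumes "orthonormal_family G e \<epsilon>" "orthonormal_family G f \<delta>"
  shows "inverse_gram e \<epsilon> = inverse_gram f \<delta>"
  by (metis assms inverse_gram_inverse matrix_mul_assoc matrix_mul_lid matrix_mul_rid)

lemma sum_rotate:
  "(\<Sum>k\<in>A. \<Sum>l\<in>B. \<Sum>i\<in>C. f k l i) = (\<Sum>i\<in>C. \<Sum>k\<in>A. \<Sum>l\<in>B. f k l i)"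
proof -
  have "(\<Sum>k\<in>A. \<Sum>l\<in>B. \<Sum>i\<in>C. f k l i) = (\<Sum>k\<in>A. \<Sum>i\<in>C. \<Sum>l\<in>B. f k l i)"
    by (intro sum.cong refl sum.swap)
  also have "\<dots> = (\<Sum>i\<in>C. \<Sum>k\<in>A. \<Sum>l\<in>B. f k l i)"
    by (rule sum.swap)
  finally show ?thesis .
qed

lemma sum_quadratic_form_eq_trace:
  "(\<Sum>i\<in>UNIV. \<epsilon> i * (e i \<bullet> (B *v e i))) = trace (inverse_gram e \<epsilon> ** B)"
proof -
  have "trace (inverse_gram e \<epsilon> ** B) = (\<Sum>k\<in>UNIV. \<Sum>l\<in>UNIV. \<Sum>i\<in>UNIV. \<epsilon> i * e i $ k * e i $ l * B $ l $ k)"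
    by (simp add: trace_def matrix_matrix_mult_def inverse_gram_def sum_distrib_right)
  also have "\<dots> = (\<Sum>i\<in>UNIV. \<Sum>k\<in>UNIV. \<Sum>l\<in>UNIV. \<epsilon> i * e i $ k * e i $ l * B $ l $ k)"
    by (rule sum_rotate)
  also have "\<dots> = (\<Sum>i\<in>UNIV. \<epsilon> i * (e i \<bullet> (B *v e i)))"
  proof (rule sum.cong[OF refl])
    fix i
    have "(\<Sum>k\<in>UNIV. \<Sum>l\<in>UNIV. \<epsilon> i * e i $ k * e i $ l * B $ l $ k)
        = (\<Sum>l\<in>UNIV. \<Sum>k\<in>UNIV. \<epsilon> i * e i $ k * e i $ l * B $ l $ k)"
      by (rule sum.swap)
    then show "(\<Sum>k\<in>UNIV. \<Sum>l\<in>UNIV. \<epsilon> i * e i $ k * e i $ l * B $ l $ k)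
        = \<epsilon> i * (e i \<bullet> (B *v e i))"
      by (simp add: inner_vec_def matrix_vector_mult_def sum_distrib_left ac_simps)
  qed
  finally show ?thesis by simp
qed

lemma sum_square_inner_eq:
  "(\<Sum>i\<in>UNIV. \<epsilon> i * (a \<bullet> e i)\<^sup>2) = a \<bullet> (inverse_gram e \<epsilon> *v a)"
proof -
  have "a \<bullet> (inverse_gram e \<epsilon> *v a) = (\<Sum>k\<in>UNIV. \<Sum>l\<in>UNIV. \<Sum>i\<in>UNIV. \<epsilon> i * (a $ k * e i $ k) * (a $ l * e i $ l))"
    by (simp add: inner_vec_def matrix_vector_mult_def inverse_gram_def sum_distrib_left sum_distrib_right ac_simps)
  also have "\<dots> = (\<Sum>i\<in>UNIV. \<Sum>k\<in>UNIV. \<Sum>l\<in>UNIV. \<epsilon> i * (a $ k * e i $ k) * (a $ l * e i $ l))"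
    by (rule sum_rotate)
  also have "\<dots> = (\<Sum>i\<in>UNIV. \<epsilon> i * (a \<bullet> e i)\<^sup>2)"
    by (simp add: inner_vec_def power2_eq_square sum_product sum_distrib_left ac_simps)
  finally show ?thesis by simp
qed

lemma inverse_gram_mult_vec:
  "inverse_gram e \<epsilon> *v a = (\<Sum>i\<in>UNIV. (\<epsilon> i * (e i \<bullet> a)) *\<^sub>R e i)"
proof -
  have "(inverse_gram e \<epsilon> *v a) $ k = (\<Sum>i\<in>UNIV. (\<epsilon> i * (e i \<bullet> a)) *\<^sub>R e i) $ k" for k
  proof -
    have "(inverse_gram e \<epsilon> *v a) $ k = (\<Sum>l\<in>UNIV. \<Sum>i\<in>UNIV. \<epsilon> i * e i $ k * e i $ l * a $ l)"
      by (simp add: matrix_vector_mult_def inverse_gram_def sum_distrib_right)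
    also have "\<dots> = (\<Sum>i\<in>UNIV. \<Sum>l\<in>UNIV. \<epsilon> i * e i $ k * e i $ l * a $ l)"
      by (rule sum.swap)
    finally show ?thesis
      by (simp add: inner_vec_def sum_distrib_left sum_distrib_right ac_simps)
  qed
  then show ?thesis by (simp add: vec_eq_iff)
qed

lemma matrix_vector_mult_sum_scaleR:
  fixes B :: "real ^ 'n ^ 'm"
  shows "B *v (\<Sum>i\<in>I. a i *\<^sub>R e i) = (\<Sum>i\<in>I. a i *\<^sub>R (B *v e i))"
  by (simp add: linear_sum[OF matrix_vector_mul_linear] linear_scale[OF matrix_vector_mul_linear])

text \<open>In the Leibniz formula, the derivative of the summand of a permutation \<open>p\<close> is a sum of terms that
  contain all but one of the factors \<open>\<delta>\<^sub>j\<^sub>,\<^sub>p\<^sub>(\<^sub>j\<^sub>)\<close>. A permutation that fixes all indices but one is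
  the identity, so only the diagonal contributes.\<close>

lemma has_derivative_det_mat_1:
  fixes F :: "'v::real_normed_vector \<Rightarrow> real ^ 'n ^ 'n"
  assumes F: "(F has_derivative F') (at x)" and Fx: "F x = mat 1"
  shows "((\<lambda>y. det (F y)) has_derivative (\<lambda>v. trace (F' v))) (at x)"
proof -
  have nth: "((\<lambda>y. F y $ i $ j) has_derivative (\<lambda>v. F' v $ i $ j)) (at x)" for i j
    by (intro bounded_linear.has_derivative[OF bounded_linear_vec_nth] F)
  let ?d = "\<lambda>v p. \<Sum>i\<in>UNIV. F' v $ i $ p i * (\<Prod>j\<in>UNIV - {i}. F x $ j $ p j)"
  have "((\<lambda>y. \<Sum>p | p permutes (UNIV::'n set). of_int (sign p) * (\<Prod>i\<in>UNIV. F y $ i $ p i))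
      has_derivative (\<lambda>v. \<Sum>p | p permutes (UNIV::'n set). of_int (sign p) * ?d v p)) (at x)"
    by (intro has_derivative_sum has_derivative_mult_right has_derivative_prod nth)
  moreover have "(\<Sum>p | p permutes (UNIV::'n set). of_int (sign p) * ?d v p) = trace (F' v)" for v
  proof -
    have "?d v p = 0" if "p permutes UNIV" "p \<noteq> id" for p :: "'n \<Rightarrow> 'n"
    proof (rule sum.neutral, rule ballI)
      fix i
      have "\<exists>j\<in>UNIV - {i}. p j \<noteq> j"
      proof (rule ccontr)
        assume "\<not> ?thesis"
        then have *: "p j = j" if "j \<noteq> i" for j using that by auto
        moreover have "p i = i"
          using * permutes_inj[OF that(1)] by (metis injD)
        ultimately have "p j = j" for j by (cases "j = i") auto
        then show False using that(2) by (auto simp: fun_eq_iff)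
      qed
      then show "F' v $ i $ p i * (\<Prod>j\<in>UNIV - {i}. F x $ j $ p j) = 0"
        by (auto simp: Fx mat_def)
    qed
    then have "(\<Sum>p | p permutes (UNIV::'n set). of_int (sign p) * ?d v p)
       = (\<Sum>p\<in>{id}. of_int (sign p) * ?d v p)"
      by (intro sum.mono_neutral_right) (auto simp: permutes_id finite_permutations)
    also have "\<dots> = trace (F' v)"
      by (simp add: Fx mat_def trace_def)
    finally show ?thesis .
  qed
  ultimately show ?thesis by (simp add: det_def)
qed

text \<open>Jacobi's formula. It follows from the case of the identity matrix since
  \<open>det (G y) = det (G x) det (H G y)\<close>.\<close>

lemma has_derivative_det:
  fixes G :: "'v::real_normed_vector \<Rightarrow> real ^ 'n ^ 'n"
  assumes G: "(G has_derivative G') (at x)" and H: "H ** G x = mat 1"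
  shows "((\<lambda>y. det (G y)) has_derivative (\<lambda>v. det (G x) * trace (H ** G' v))) (at x)"
proof -
  have bl: "bounded_linear ((**) H)"
    by (intro linear_conv_bounded_linear[THEN iffD1] linearI)
      (simp_all add: matrix_add_ldistrib scalar_matrix_assoc matrix_scalar_ac)
  have "((\<lambda>y. det (H ** G y)) has_derivative (\<lambda>v. trace (H ** G' v))) (at x)"
    by (rule has_derivative_det_mat_1[OF bounded_linear.has_derivative[OF bl G] H])
  then have "((\<lambda>y. det (G x) * det (H ** G y)) has_derivative (\<lambda>v. det (G x) * trace (H ** G' v))) (at x)"
    by (rule has_derivative_mult_right)
  moreover have "det (G x) * det H = 1"
    by (metis H det_mul det_I mult.commute)
  then have "det (G x) * det (H ** G y) = det (G y)" for y
    by (metis det_mul mult.assoc mult_1)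
  ultimately show ?thesis by simp
qed

text \<open>The double sum \<open>\<Sum>\<^sub>i\<^sub>j \<delta>\<^sub>i \<delta>\<^sub>j F(f\<^sub>i,f\<^sub>j)\<^sup>2\<close> is the trace of \<open>H F H F\<^sup>T\<close> with \<open>H = G\<^sup>-\<^sup>1\<close>, so the
  family \<open>f\<close> may be replaced by one that is adapted to \<open>U\<close>. Such a family is the image of \<open>e\<close>
  under the reflection in the hyperplane orthogonal to \<open>e\<^sub>k - V\<close>, where \<open>V\<close> is a unit multiple of
  \<open>U\<close>: the reflection is an isometry that maps \<open>e\<^sub>k\<close> to \<open>V\<close>. There, the negative terms of the
  double sum are \<open>-2 \<Sum>\<^sub>j F(V,h\<^sub>j)\<^sup>2\<close>, which is the left hand side, as \<open>Z\<close> represents \<open>F(U,\<cdot>)\<close>.\<close>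

lemma lorentzian_skew_form_inequality:
  fixes G F :: "real ^ 'n ^ 'n"
  assumes sym: "transpose G = G"
    and e: "orthonormal_family G e \<epsilon>" and k: "\<And>i. \<epsilon> i = (if i = k then -1 else 1)"
    and f: "orthonormal_family G f \<delta>"
    and skew: "\<And>v w. v \<bullet> (F *v w) = - (w \<bullet> (F *v v))"
    and U: "U \<bullet> (G *v U) < 0"
    and Z: "\<And>w. Z \<bullet> (G *v w) = U \<bullet> (F *v w)"
  shows "2 / (U \<bullet> (G *v U)) * (Z \<bullet> (G *v Z))
    \<le> (\<Sum>i\<in>UNIV. \<Sum>j\<in>UNIV. \<delta> i * \<delta> j * (f i \<bullet> (F *v f j))\<^sup>2)"
proof -
  define b where "b v w = v \<bullet> (G *v w)" for v w
  have b_sym: "b v w = b w v" for v w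
    unfolding b_def by (rule symmetric_matrix_inner[OF sym])
  have b_diff: "b (v - v') w = b v w - b v' w" and b_scale: "b (a *\<^sub>R v) w = a * b v w" for v v' w a
    by (simp_all add: b_def inner_diff_left)
  have b_diff': "b w (v - v') = b w v - b w v'" and b_scale': "b w (a *\<^sub>R v) = a * b w v" for v v' w a
    by (metis b_sym b_diff) (metis b_sym b_scale)
  have be: "b (e i) (e j) = (if i = j then \<epsilon> i else 0)" for i j
    using e by (simp add: orthonormal_family_def b_def)
  have bU: "b U U < 0" using U by (simp add: b_def)
  \<comment> \<open>the sign is chosen so that \<open>b (e k) V \<ge> 0\<close>; then \<open>e k - V\<close> is not a null vector\<close>
  define l where "l = (if b (e k) U \<ge> 0 then sqrt (- b U U) else - sqrt (- b U U))"
  have l2: "l\<^sup>2 = - b U U" "l \<noteq> 0"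
    using bU by (auto simp: l_def)
  define V where "V = (1 / l) *\<^sub>R U"
  have UV: "U = l *\<^sub>R V" using l2 by (simp add: V_def)
  have bVV: "b V V = -1"
    using l2 bU by (simp add: V_def b_scale b_scale' field_simps power2_eq_square)
  have bkV: "b (e k) V \<ge> 0"
    using bU by (auto simp: V_def b_scale' l_def divide_simps zero_le_mult_iff)
  define n where "n = e k - V"
  have bnn: "b n n = - 2 - 2 * b (e k) V"
    unfolding n_def b_diff b_diff' using be[of k k] b_sym[of "e k" V] bVV by (simp add: k)
  have nn: "b n n < 0" using bnn bkV by simp
  define R where "R v = v - (2 * b v n / b n n) *\<^sub>R n" for v
  have R: "b (R v) (R w) = b v w" for v w
    using nn b_sym[of n w] by (simp add: R_def b_diff b_diff' b_scale b_scale' field_simps)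
  have "b (e k) n = b (e k) (e k) - b (e k) V"
    by (simp only: n_def b_diff')
  then have "2 * b (e k) n / b n n = 1"
    using be[of k k] nn by (simp add: bnn k)
  then have Rk: "R (e k) = V" unfolding R_def by (simp add: n_def)
  define h where "h i = R (e i)" for i
  have h: "orthonormal_family G h \<epsilon>"
    using e R by (simp add: orthonormal_family_def h_def b_def)
  define S where "S i j = (h i \<bullet> (F *v h j))\<^sup>2" for i j
  have S_sym: "S i j = S j i" for i j
    unfolding S_def by (subst skew) simp
  have S_sym': "(\<Sum>i\<in>-{k}. S i k) = (\<Sum>i\<in>-{k}. S k i)"
    by (rule sum.cong[OF refl S_sym])
  have S_kk: "S k k = 0"
    using skew[of "h k" "h k"] by (simp add: S_def)
  have inner_tr: "v \<bullet> (F *v w) = (v v* F) \<bullet> w" for v w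
    by (simp add: dot_lmul_matrix)
  have basis_indep: "(\<Sum>i\<in>UNIV. \<Sum>j\<in>UNIV. \<alpha> i * \<alpha> j * (a i \<bullet> (F *v a j))\<^sup>2)
      = trace (inverse_gram a \<alpha> ** (F ** (inverse_gram a \<alpha> ** transpose F)))"
    if a: "orthonormal_family G a \<alpha>" for a \<alpha>
  proof -
    have "(\<Sum>j\<in>UNIV. \<alpha> i * \<alpha> j * (a i \<bullet> (F *v a j))\<^sup>2)
        = \<alpha> i * (a i \<bullet> ((F ** (inverse_gram a \<alpha> ** transpose F)) *v a i))" for i
    proof -
      have "(\<Sum>j\<in>UNIV. \<alpha> i * \<alpha> j * (a i \<bullet> (F *v a j))\<^sup>2)
          = \<alpha> i * (\<Sum>j\<in>UNIV. \<alpha> j * ((a i v* F) \<bullet> a j)\<^sup>2)"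
        by (simp add: sum_distrib_left inner_tr mult.assoc)
      also have "\<dots> = \<alpha> i * (a i \<bullet> (F *v (inverse_gram a \<alpha> *v (transpose F *v a i))))"
        unfolding sum_square_inner_eq by (simp add: inner_tr)
      finally show ?thesis by (simp only: matrix_vector_mul_assoc)
    qed
    then show ?thesis
      using sum_quadratic_form_eq_trace[of \<alpha> a] by simp
  qed
  have "(\<Sum>i\<in>UNIV. \<Sum>j\<in>UNIV. \<delta> i * \<delta> j * (f i \<bullet> (F *v f j))\<^sup>2)
      = (\<Sum>i\<in>UNIV. \<Sum>j\<in>UNIV. \<epsilon> i * \<epsilon> j * S i j)"
    unfolding S_def basis_indep[OF f] basis_indep[OF h] inverse_gram_unique[OF f h] ..
  also have "\<dots> = (\<Sum>i\<in>insert k (-{k}). \<Sum>j\<in>insert k (-{k}). \<epsilon> i * \<epsilon> j * S i j)"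
    by (simp add: insert_UNIV Compl_eq_Diff_UNIV insert_absorb)
  also have "\<dots> = (\<Sum>i\<in>-{k}. \<Sum>j\<in>-{k}. S i j) - 2 * (\<Sum>j\<in>-{k}. S k j)"
    by (simp add: k S_kk sum.distrib sum_negf sum_subtractf S_sym')
  also have "\<dots> \<ge> - 2 * (\<Sum>j\<in>-{k}. S k j)"
    by (simp add: S_def sum_nonneg)
  finally have *: "- 2 * (\<Sum>j\<in>-{k}. S k j)
      \<le> (\<Sum>i\<in>UNIV. \<Sum>j\<in>UNIV. \<delta> i * \<delta> j * (f i \<bullet> (F *v f j))\<^sup>2)" .
  have "b Z Z = (\<Sum>j\<in>UNIV. \<epsilon> j * (b Z (h j))\<^sup>2)"
  proof -
    have "(\<Sum>j\<in>UNIV. \<epsilon> j * (b Z (h j))\<^sup>2) = (\<Sum>j\<in>UNIV. \<epsilon> j * ((G *v Z) \<bullet> h j)\<^sup>2)"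
      unfolding b_def by (simp add: symmetric_matrix_inner[OF sym, of Z] inner_commute)
    also have "\<dots> = (G *v Z) \<bullet> ((inverse_gram h \<epsilon> ** G) *v Z)"
      unfolding sum_square_inner_eq by (simp add: matrix_vector_mul_assoc)
    also have "\<dots> = b Z Z"
      by (simp add: inverse_gram_inverse[OF h] b_def inner_commute)
    finally show ?thesis by simp
  qed
  also have "\<dots> = (\<Sum>j\<in>UNIV. \<epsilon> j * (l\<^sup>2 * S k j))"
  proof -
    have "b Z (h j) = l * (h k \<bullet> (F *v h j))" for j
      unfolding b_def Z using UV Rk by (simp add: h_def)
    then show ?thesis by (simp add: S_def power_mult_distrib)
  qed
  also have "\<dots> = (\<Sum>j\<in>insert k (-{k}). \<epsilon> j * (l\<^sup>2 * S k j))"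
    by (simp add: insert_UNIV Compl_eq_Diff_UNIV insert_absorb)
  also have "\<dots> = l\<^sup>2 * (\<Sum>j\<in>-{k}. S k j)"
    by (simp add: k S_kk sum_distrib_left)
  finally have "2 / b U U * b Z Z = - 2 * (\<Sum>j\<in>-{k}. S k j)"
    using l2 bU by (simp add: field_simps)
  with * show ?thesis by (simp add: b_def)
qed

section \<open>Integrals of directional derivatives\<close>

text \<open>The difference quotients of \<open>\<phi>\<close> in the direction \<open>e\<close> have integral \<open>0\<close> because the Lebesgue measure
  is invariant under translations. They converge to the derivative and are dominated, being
  bounded by the Lipschitz constant of \<open>\<phi>\<close> and supported in a fixed ball.\<close>

lemma integral_directional_derivative_eq_0:
  fixes \<phi> :: "'b::euclidean_space \<Rightarrow> real"
  assumes d: "\<And>x. (\<phi> has_derivative \<phi>' x) (at x)"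
    and cont: "continuous_on UNIV (\<lambda>x. \<phi>' x e)"
    and K: "compact K" "\<And>x. x \<notin> K \<Longrightarrow> \<phi> x = 0"
  shows "has_bochner_integral lborel (\<lambda>x. \<phi>' x e) 0"
proof -
  have c\<phi>: "continuous_on UNIV \<phi>"
    using d by (auto intro!: continuous_at_imp_continuous_on has_derivative_continuous)
  have int: "integrable lborel \<phi>"
  proof -
    have "integrable lborel (\<lambda>x. indicator K x *\<^sub>R \<phi> x)"
      using borel_integrable_compact[OF K(1)] c\<phi> continuous_on_subset by blast
    also have "(\<lambda>x. indicator K x *\<^sub>R \<phi> x) = \<phi>"
      using K(2) by (auto simp: fun_eq_iff indicator_def)
    finally show ?thesis .
  qed
  have d0: "\<phi>' x e = 0" if "x \<notin> K" for x
  proof -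
    have "(\<phi> has_derivative (\<lambda>_. 0)) (at x)"
      by (rule has_derivative_transform_within_open[of "\<lambda>_. 0" _ _ _ "- K"])
        (use that K in \<open>auto simp: open_Compl compact_imp_closed\<close>)
    then show ?thesis using d has_derivative_unique by metis
  qed
  obtain C where C: "C \<ge> 0" "\<And>x. \<bar>\<phi>' x e\<bar> \<le> C"
  proof -
    have "bounded ((\<lambda>x. \<phi>' x e) ` K)"
      using K(1) cont continuous_on_subset by (blast intro: compact_imp_bounded compact_continuous_image)
    then obtain C where "\<forall>x\<in>K. \<bar>\<phi>' x e\<bar> \<le> C" by (auto simp: bounded_iff)
    then have "\<bar>\<phi>' x e\<bar> \<le> max C 0" for x
      using d0[of x] by (cases "x \<in> K") auto
    then show thesis using that[of "max C 0"] by auto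
  qed
  have lip: "\<bar>\<phi> (x + s *\<^sub>R e) - \<phi> x\<bar> \<le> C * s" if "s \<ge> 0" for x s
  proof -
    have dt: "((\<lambda>t. \<phi> (x + t *\<^sub>R e)) has_derivative (\<lambda>h. \<phi>' (x + t *\<^sub>R e) (h *\<^sub>R e))) (at t within T)" for t T
      by (rule has_derivative_compose[OF _ d, of "\<lambda>t. x + t *\<^sub>R e"])
        (auto intro!: derivative_eq_intros)
    have "norm (\<phi> (x + s *\<^sub>R e) - \<phi> (x + 0 *\<^sub>R e)) \<le> C * norm (s - 0)"
    proof (rule differentiable_bound[OF convex_UNIV dt])
      show "onorm (\<lambda>h. \<phi>' (x + t *\<^sub>R e) (h *\<^sub>R e)) \<le> C" for t
      proof (rule onorm_le)
        fix h :: real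
        have "\<phi>' (x + t *\<^sub>R e) (h *\<^sub>R e) = h * \<phi>' (x + t *\<^sub>R e) e"
          using linear_scale[OF has_derivative_linear[OF d]] by simp
        then show "norm (\<phi>' (x + t *\<^sub>R e) (h *\<^sub>R e)) \<le> C * norm h"
          using C(2)[of "x + t *\<^sub>R e"] by (simp add: abs_mult mult.commute[of C] mult_left_mono)
      qed
    qed auto
    then show ?thesis using that by simp
  qed
  define q where "q n x = (\<phi> (x + (1 / real (Suc n)) *\<^sub>R e) - \<phi> x) * real (Suc n)" for n x
  obtain B where B: "\<And>x. x \<in> K \<Longrightarrow> norm x \<le> B"
    using compact_imp_bounded[OF K(1)] by (auto simp: bounded_iff)
  let ?w = "\<lambda>x. C * indicator (cball 0 (B + norm e)) x :: real"
  have shift: "has_bochner_integral lborel (\<lambda>x. \<phi> (x + a)) (integral\<^sup>L lborel \<phi>)" for a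
  proof -
    have "has_bochner_integral (distr lborel borel ((+) a)) \<phi> (integral\<^sup>L lborel \<phi>)"
      unfolding lborel_distr_plus using int by (rule has_bochner_integral_integrable)
    then have "has_bochner_integral lborel (\<lambda>x. \<phi> (a + x)) (integral\<^sup>L lborel \<phi>)"
      using borel_measurable_continuous_onI[OF c\<phi>]
      by (simp add: has_bochner_integral_iff integrable_distr_eq integral_distr)
    then show ?thesis by (simp add: add.commute)
  qed
  have q0: "has_bochner_integral lborel (q n) 0" for n
    using has_bochner_integral_mult_left[OF has_bochner_integral_diff[OF shift shift[of 0]], where c="real (Suc n)"]
    by (simp add: q_def[abs_def])
  have lim: "(\<lambda>n. q n x) \<longlonglongrightarrow> \<phi>' x e" for x
  proof -
    have dt: "((\<lambda>t. \<phi> (x + t *\<^sub>R e)) has_derivative (\<lambda>h. \<phi>' x (h *\<^sub>R e))) (at 0)"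
    proof -
      have "((\<lambda>t. x + t *\<^sub>R e) has_derivative (\<lambda>h. h *\<^sub>R e)) (at 0)"
        by (auto intro!: derivative_eq_intros)
      from has_derivative_compose[OF this d] show ?thesis by simp
    qed
    have "(\<lambda>h. \<phi>' x (h *\<^sub>R e)) = (*) (\<phi>' x e)"
      using linear_scale[OF has_derivative_linear[OF d]] by (auto simp: mult.commute)
    with dt have "((\<lambda>t. \<phi> (x + t *\<^sub>R e)) has_field_derivative \<phi>' x e) (at 0)"
      by (simp add: has_field_derivative_def)
    then have *: "(\<lambda>h. (\<phi> (x + h *\<^sub>R e) - \<phi> x) / h) \<midarrow>0\<rightarrow> \<phi>' x e"
      by (simp add: DERIV_def)
    have "filterlim (\<lambda>n. 1 / real (Suc n)) (at 0) sequentially"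
      unfolding filterlim_at using LIMSEQ_inverse_real_of_nat by (auto simp: field_simps)
    from filterlim_compose[OF * this] show ?thesis
      by (simp add: q_def)
  qed
  have bound: "norm (q n x) \<le> ?w x" for n x
  proof (cases "norm x \<le> B + norm e")
    case True
    have "\<bar>q n x\<bar> \<le> C * (1 / real (Suc n)) * real (Suc n)"
      unfolding q_def abs_mult using lip[of "1 / real (Suc n)" x]
      by (intro mult_mono) auto
    then show ?thesis using True by simp
  next
    case False
    have 1: "norm ((1 / real (Suc n)) *\<^sub>R e) \<le> norm e"
      by (simp add: divide_le_eq mult_left_le_one_le algebra_simps)
    have "x \<notin> K" using B[of x] False norm_ge_zero[of e] by linarith
    moreover have "x + (1 / real (Suc n)) *\<^sub>R e \<notin> K"
    proof
      assume "x + (1 / real (Suc n)) *\<^sub>R e \<in> K"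
      from B[OF this] 1 False norm_triangle_ineq4[of "x + (1 / real (Suc n)) *\<^sub>R e" "(1 / real (Suc n)) *\<^sub>R e"]
      show False by simp
    qed
    ultimately show ?thesis using K(2) by (simp add: q_def C)
  qed
  have wint: "integrable lborel ?w"
    by (intro integrable_mult_right integrable_real_indicator)
      (use emeasure_compact_finite[OF compact_cball] in auto)
  have m: "(\<lambda>x. \<phi>' x e) \<in> borel_measurable lborel"
    using borel_measurable_continuous_onI[OF cont] by simp
  have mq: "q n \<in> borel_measurable lborel" for n
    using q0[of n] by (auto simp: has_bochner_integral_iff dest: borel_measurable_integrable)
  have ae: "AE x in lborel. (\<lambda>n. q n x) \<longlonglongrightarrow> \<phi>' x e" "\<And>n. AE x in lborel. norm (q n x) \<le> ?w x"
    using lim bound by simp_all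
  have "integrable lborel (\<lambda>x. \<phi>' x e)"
    by (rule integrable_dominated_convergence[OF m mq wint ae])
  moreover have "(\<lambda>n. integral\<^sup>L lborel (q n)) \<longlonglongrightarrow> integral\<^sup>L lborel (\<lambda>x. \<phi>' x e)"
    by (rule integral_dominated_convergence[OF m mq wint ae])
  moreover have "integral\<^sup>L lborel (q n) = 0" for n
    using q0 by (simp add: has_bochner_integral_iff)
  ultimately show ?thesis
    by (simp add: has_bochner_integral_iff LIMSEQ_const_iff)
qed

section \<open>Charts, tangent vectors and extension of local vector fields\<close>

lemma vec_eq_sum_axis: "v = (\<Sum>i\<in>UNIV. (v $ i) *\<^sub>R axis i (1::real))"
  using basis_expansion[of v] by (simp add: scalar_mult_eq_scaleR)

locale manifold =
  fixes M :: "'a topology" and A :: "('a, 'n::finite) chart set"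
  assumes manifold: "smooth_manifold M A"
begin

lemma chart: "c \<in> A \<Longrightarrow> is_chart M c"
  using manifold by (auto simp: smooth_manifold_def smooth_atlas_def)

lemma cdom_subset: "c \<in> A \<Longrightarrow> cdom c \<subseteq> topspace M"
  using chart by (auto simp: is_chart_def openin_subset)

lemma openin_cdom: "c \<in> A \<Longrightarrow> openin M (cdom c)"
  using chart by (auto simp: is_chart_def)

lemma open_cimg: "c \<in> A \<Longrightarrow> open (cimg c)"
  using chart by (auto simp: is_chart_def)

lemma chart_homeo: "c \<in> A \<Longrightarrow> homeomorphic_map (subtopology M (cdom c)) (top_of_set (cimg c)) (cmap c)"
  using chart by (auto simp: is_chart_def)

lemma topspace_cdom: "c \<in> A \<Longrightarrow> topspace (subtopology M (cdom c)) = cdom c"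
  using cdom_subset by (simp add: inf.absorb2)

lemma inj_cmap: "c \<in> A \<Longrightarrow> inj_on (cmap c) (cdom c)"
  using homeomorphic_imp_injective_map[OF chart_homeo] topspace_cdom by metis

lemma cinv_cmap: "c \<in> A \<Longrightarrow> p \<in> cdom c \<Longrightarrow> cinv c (cmap c p) = p"
  using inj_cmap by (simp add: inv_into_f_f)

lemma cmap_cinv: "x \<in> cimg c \<Longrightarrow> cmap c (cinv c x) = x"
  by (rule f_inv_into_f)

lemma cinv_in: "x \<in> cimg c \<Longrightarrow> cinv c x \<in> cdom c"
  by (rule inv_into_into)

lemma charts_atI: "c \<in> A \<Longrightarrow> p \<in> cdom c \<Longrightarrow> c \<in> charts_at A p"
  by (simp add: charts_at_def)

lemma ex_chart: "p \<in> topspace M \<Longrightarrow> \<exists>c\<in>A. p \<in> cdom c"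
  using manifold by (auto simp: smooth_manifold_def smooth_atlas_def)

lemma open_cmap_image:
  assumes "c \<in> A" "openin M W"
  shows "open (cmap c ` (cdom c \<inter> W))"
proof -
  have "openin (subtopology M (cdom c)) (cdom c \<inter> W)"
    using assms by (simp add: openin_subtopology_Int2)
  then have "openin (top_of_set (cimg c)) (cmap c ` (cdom c \<inter> W))"
    using homeomorphic_map_openness_eq[OF chart_homeo[OF assms(1)]] by blast
  then show ?thesis
    using open_cimg[OF assms(1)] openin_open_trans by blast
qed

lemma openin_cmap_preimage:
  assumes "c \<in> A" "open T"
  shows "openin M {p \<in> cdom c. cmap c p \<in> T}"
proof -
  have "continuous_map (subtopology M (cdom c)) euclidean (cmap c)"
    using homeomorphic_imp_continuous_map[OF chart_homeo[OF assms(1)]]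
    by (simp add: continuous_map_in_subtopology)
  then have "openin (subtopology M (cdom c)) {p \<in> topspace (subtopology M (cdom c)). cmap c p \<in> T}"
    using assms(2) by (intro openin_continuous_map_preimage) auto
  then show ?thesis
    unfolding topspace_cdom[OF assms(1)] using openin_cdom[OF assms(1)] openin_trans_full by blast
qed

text \<open>The preimage of \<open>K\<close> is compact, hence closed in the Hausdorff space \<open>M\<close>. This is what allows local
  objects with support in \<open>K\<close> to be extended by zero.\<close>

lemma closedin_cmap_preimage:
  assumes "c \<in> A" "compact K" "K \<subseteq> cimg c"
  shows "closedin M {p \<in> cdom c. cmap c p \<in> K}"
proof -
  have "cmap c ` {p \<in> cdom c. cmap c p \<in> K} = K" using assms(3) by auto
  then have "compactin (subtopology M (cdom c)) {p \<in> cdom c. cmap c p \<in> K}"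
    using assms homeomorphic_map_compactness_eq[OF chart_homeo[OF assms(1)], of "{p \<in> cdom c. cmap c p \<in> K}"]
      cdom_subset[OF assms(1)]
    by (auto simp: compactin_subtopology)
  then show ?thesis
    using manifold by (auto simp: compactin_subtopology smooth_manifold_def intro: compactin_imp_closedin)
qed

lemma smooth_transition:
  "c \<in> A \<Longrightarrow> c' \<in> A \<Longrightarrow> smooth_on (cmap c ` (cdom c \<inter> cdom c')) (transition c c')"
  using manifold by (auto simp: smooth_manifold_def smooth_atlas_def)

lemma transition_cmap: "c \<in> A \<Longrightarrow> p \<in> cdom c \<Longrightarrow> transition c c' (cmap c p) = cmap c' p"
  by (simp add: transition_def cinv_cmap)

abbreviation dtrans :: "('a, 'n) chart \<Rightarrow> ('a, 'n) chart \<Rightarrow> 'a \<Rightarrow> real ^ 'n \<Rightarrow> real ^ 'n" where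
  "dtrans c c' p \<equiv> frechet_derivative (transition c c') (at (cmap c p))"

lemma has_derivative_transition:
  assumes "c \<in> A" "c' \<in> A" "p \<in> cdom c" "p \<in> cdom c'"
  shows "(transition c c' has_derivative dtrans c c' p) (at (cmap c p))"
  by (rule smooth_on_has_derivative[OF smooth_transition[OF assms(1,2)]]) (use assms in auto)

lemma bounded_linear_dtrans:
  assumes "c \<in> A" "c' \<in> A" "p \<in> cdom c" "p \<in> cdom c'"
  shows "bounded_linear (dtrans c c' p)"
  using has_derivative_bounded_linear[OF has_derivative_transition[OF assms]] .

text \<open>The cocycle condition that makes \<open>tvec_of\<close> define a tangent vector.\<close>

lemma dtrans_comp:
  assumes c: "c \<in> A" "c' \<in> A" "c'' \<in> A" and p: "p \<in> cdom c" "p \<in> cdom c'" "p \<in> cdom c''"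
  shows "dtrans c' c'' p (dtrans c c' p w) = dtrans c c'' p w"
proof -
  have "((transition c' c'' \<circ> transition c c') has_derivative (dtrans c' c'' p \<circ> dtrans c c' p)) (at (cmap c p))"
    using has_derivative_transition[of c' c'' p] c p
    by (intro diff_chain_at has_derivative_transition) (simp_all add: transition_cmap)
  then have "(transition c c'' has_derivative (dtrans c' c'' p \<circ> dtrans c c' p)) (at (cmap c p))"
    by (rule has_derivative_transform_within_open[where s="cmap c ` (cdom c \<inter> cdom c')"])
      (use c p open_cmap_image[OF c(1) openin_cdom[OF c(2)]] in \<open>auto simp: transition_def cinv_cmap\<close>)
  then show ?thesis
    using frechet_derivative_at by (metis comp_apply)
qed

lemma dtrans_self:
  assumes "c \<in> A" "p \<in> cdom c"
  shows "dtrans c c p w = w"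
proof -
  have "((\<lambda>x. x) has_derivative (\<lambda>x. x)) (at (cmap c p))" by simp
  then have "(transition c c has_derivative (\<lambda>x. x)) (at (cmap c p))"
    by (rule has_derivative_transform_within_open[where s="cimg c"])
      (use assms open_cimg in \<open>auto simp: transition_def cinv_cmap\<close>)
  then show ?thesis
    using frechet_derivative_at by metis
qed

lemma tvec_of_in:
  assumes "c \<in> A" "p \<in> cdom c"
  shows "tvec_of A c p w \<in> tangent_space A p"
  unfolding tangent_space_def
proof (rule CollectI, intro conjI ballI allI impI)
  fix c' c'' assume "c' \<in> charts_at A p" "c'' \<in> charts_at A p"
  then show "tvec_of A c p w c'' = dtrans c' c'' p (tvec_of A c p w c')"
    using dtrans_comp[of c c' c'' p w] assms by (simp add: tvec_of_def charts_at_def)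
qed (simp add: tvec_of_def)

lemma tvec_of_self:
  "c \<in> A \<Longrightarrow> p \<in> cdom c \<Longrightarrow> tvec_of A c p w c = w"
  by (simp add: tvec_of_def charts_at_def dtrans_self)

text \<open>Oriented so that it eliminates the derivatives of transition maps; the defining equation, read from
  left to right, can be applied forever.\<close>

lemma tangent_trans:
  assumes "v \<in> tangent_space A p" "c \<in> charts_at A p" "c' \<in> charts_at A p"
  shows "dtrans c c' p (v c) = v c'"
proof -
  have "\<forall>c\<in>charts_at A p. \<forall>c'\<in>charts_at A p. v c' = dtrans c c' p (v c)"
    using assms(1) unfolding tangent_space_def mem_Collect_eq by (rule conjunct1)
  then show ?thesis using assms(2,3) by (metis (no_types))
qed

lemma tangent_outside:
  assumes "v \<in> tangent_space A p" "c \<notin> charts_at A p"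
  shows "v c = 0"
proof -
  have "\<forall>c. c \<notin> charts_at A p \<longrightarrow> v c = 0"
    using assms(1) unfolding tangent_space_def mem_Collect_eq by (rule conjunct2)
  then show ?thesis using assms(2) by (metis (no_types))
qed

lemma tvec_of_components:
  assumes "v \<in> tangent_space A p" "c \<in> A" "p \<in> cdom c"
  shows "tvec_of A c p (v c) = v"
  by (rule ext) (simp add: tvec_of_def tangent_trans[OF assms(1) charts_atI[OF assms(2,3)]] tangent_outside[OF assms(1)])

lemma tangent_eqI:
  "u \<in> tangent_space A p \<Longrightarrow> v \<in> tangent_space A p \<Longrightarrow> c \<in> A \<Longrightarrow> p \<in> cdom c \<Longrightarrow> u c = v c \<Longrightarrow> u = v"
  by (metis (no_types) tvec_of_components)

lemma tangent_comb:
  assumes "u \<in> tangent_space A p" "v \<in> tangent_space A p"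
  shows "(\<lambda>c. a *\<^sub>R u c + b *\<^sub>R v c) \<in> tangent_space A p"
  unfolding tangent_space_def
proof (rule CollectI, intro conjI ballI allI impI)
  fix c c' assume c: "c \<in> charts_at A p" "c' \<in> charts_at A p"
  interpret bounded_linear "dtrans c c' p"
    using c by (simp add: charts_at_def bounded_linear_dtrans)
  show "a *\<^sub>R u c' + b *\<^sub>R v c' = dtrans c c' p (a *\<^sub>R u c + b *\<^sub>R v c)"
    by (simp add: add scaleR tangent_trans[OF assms(1) c] tangent_trans[OF assms(2) c])
qed (simp add: tangent_outside[OF assms(1)] tangent_outside[OF assms(2)])

lemma tangent_zero: "(\<lambda>_. 0) \<in> tangent_space A p"
  unfolding tangent_space_def
proof (rule CollectI, intro conjI ballI allI impI)
  fix c c' assume c: "c \<in> charts_at A p" "c' \<in> charts_at A p"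
  interpret bounded_linear "dtrans c c' p"
    using c by (simp add: charts_at_def bounded_linear_dtrans)
  show "0 = dtrans c c' p 0" by (simp add: zero)
qed simp

lemma vector_field_comb:
  assumes "vector_field A X" "vector_field A Y"
  shows "vector_field A (\<lambda>p c. a *\<^sub>R X p c + b *\<^sub>R Y p c)"
  using assms tangent_comb unfolding vector_field_def
  by (auto intro!: smooth_on_add smooth_on_scaleR smooth_on_const open_cimg)

lemma vector_field_diff:
  "vector_field A X \<Longrightarrow> vector_field A Y \<Longrightarrow> vector_field A (vf_diff X Y)"
  using vector_field_comb[of X Y 1 "-1"] by (simp add: vf_diff_def)

lemma vector_field_tangent: "vector_field A X \<Longrightarrow> X p \<in> tangent_space A p"
  by (simp add: vector_field_def)

lemma vector_field_smooth: "vector_field A X \<Longrightarrow> c \<in> A \<Longrightarrow> smooth_on (cimg c) (\<lambda>x. X (cinv c x) c)"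
  by (simp add: vector_field_def)

text \<open>The extension by zero of the local vector field with components \<open>w\<close>. The explicit case distinction
  is essential: outside the domain of \<open>c\<close> the derivatives that occur in \<open>tvec_of\<close> are unspecified.\<close>

definition ext_field :: "('a, 'n) chart \<Rightarrow> (real ^ 'n) set \<Rightarrow> (real ^ 'n \<Rightarrow> real ^ 'n) \<Rightarrow> ('a, 'n) vfield" where
  "ext_field c K w p = (if p \<in> cdom c \<and> cmap c p \<in> K then tvec_of A c p (w (cmap c p)) else (\<lambda>_. 0))"

text \<open>Smoothness is local. Near a point of the chart domain that \<open>S\<close> describes, the components in another
  chart are obtained by applying the derivative of the transition map to \<open>w\<close>; any other point has
  a neighbourhood that does not meet the closed set described by \<open>K\<close>, and the field is zero there.\<close>

lemma vector_field_ext_field: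
  assumes c: "c \<in> A" and S: "open S" "S \<subseteq> cimg c" and K: "compact K" "K \<subseteq> S"
    and w: "smooth_on S w" "\<And>x. x \<in> S - K \<Longrightarrow> w x = 0"
  shows "vector_field A (ext_field c K w)"
  unfolding vector_field_def
proof (intro conjI allI ballI)
  show "ext_field c K w p \<in> tangent_space A p" for p
    using c by (auto simp: ext_field_def tvec_of_in tangent_zero)
next
  fix c' assume c': "c' \<in> A"
  let ?S = "{p \<in> cdom c. cmap c p \<in> S}" and ?K = "{p \<in> cdom c. cmap c p \<in> K}"
  have oS: "openin M ?S" using openin_cmap_preimage[OF c S(1)] .
  have cK: "openin M (topspace M - ?K)"
    using closedin_cmap_preimage[OF c K(1)] K S by blast
  show "smooth_on (cimg c') (\<lambda>x. ext_field c K w (cinv c' x) c')"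
  proof (rule smooth_on_local)
    fix y assume y: "y \<in> cimg c'"
    define q where "q = cinv c' y"
    have q: "q \<in> cdom c'" "cmap c' q = y" using y by (auto simp: q_def intro: cinv_in cmap_cinv)
    show "\<exists>T. open T \<and> y \<in> T \<and> smooth_on T (\<lambda>x. ext_field c K w (cinv c' x) c')"
    proof (cases "q \<in> ?S")
      case True
      define T where "T = cmap c' ` (cdom c' \<inter> ?S)"
      define R where "R = cmap c ` (cdom c \<inter> (?S \<inter> cdom c'))"
      have oT: "open T" unfolding T_def by (rule open_cmap_image[OF c' oS])
      have oR: "open R" unfolding R_def
        by (rule open_cmap_image[OF c openin_Int[OF oS openin_cdom[OF c']]])
      have RS: "R \<subseteq> S" and R': "R \<subseteq> cmap c ` (cdom c \<inter> cdom c')" by (auto simp: R_def)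
      define h where "h y = (\<Sum>i\<in>UNIV. (w y $ i) *\<^sub>R frechet_derivative (transition c c') (at y) (axis i 1))" for y
      have "smooth_on R h"
        unfolding h_def
        by (intro smooth_on_sum smooth_on_scaleR smooth_on_vec_nth oR smooth_on_subset[OF w(1) RS]
            smooth_on_frechet_derivative smooth_on_subset[OF smooth_transition[OF c c'] R'])
      moreover have "transition c' c ` T \<subseteq> R"
        using c' by (auto simp: T_def R_def transition_cmap)
      moreover have "smooth_on T (transition c' c)"
        by (rule smooth_on_subset[OF smooth_transition[OF c' c]]) (auto simp: T_def)
      ultimately have "smooth_on T (\<lambda>x. h (transition c' c x))"
        by (intro smooth_on_compose[OF oT oR, of "transition c' c" h])
      moreover have "h (transition c' c x) = ext_field c K w (cinv c' x) c'" if "x \<in> T" for x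
      proof -
        from that obtain p where p: "p \<in> cdom c'" "p \<in> cdom c" "cmap c p \<in> S" "x = cmap c' p"
          by (auto simp: T_def)
        interpret bounded_linear "dtrans c c' p"
          using c c' p by (intro bounded_linear_dtrans)
        have "dtrans c c' p (w (cmap c p)) = h (cmap c p)"
          using arg_cong[OF vec_eq_sum_axis[of "w (cmap c p)"], of "dtrans c c' p"]
          by (simp only: h_def sum scaleR)
        moreover have "dtrans c c' p (w (cmap c p)) = ext_field c K w p c'"
        proof (cases "cmap c p \<in> K")
          case True
          then show ?thesis using p charts_atI[OF c' p(1)] by (simp add: ext_field_def tvec_of_def)
        next
          case False
          then show ?thesis using p(3) by (simp add: ext_field_def zero w(2))
        qed
        ultimately show ?thesis using p c c' by (simp add: transition_cmap cinv_cmap)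
      qed
      ultimately have "smooth_on T (\<lambda>x. ext_field c K w (cinv c' x) c')"
        by (rule smooth_on_cong_imp[OF oT, rotated])
      then show ?thesis using oT q True by (auto simp: T_def)
    next
      case False
      define T where "T = cmap c' ` (cdom c' \<inter> (topspace M - ?K))"
      have oT: "open T" unfolding T_def by (rule open_cmap_image[OF c' cK])
      have "0 = ext_field c K w (cinv c' x) c'" if "x \<in> T" for x
        using that c' by (auto simp: T_def ext_field_def cinv_cmap)
      then have "smooth_on T (\<lambda>x. ext_field c K w (cinv c' x) c')"
        by (rule smooth_on_cong_imp[OF oT _ smooth_on_const[OF oT]])
      moreover have "y \<in> T"
        using False q K(2) cdom_subset[OF c'] by (auto simp: T_def)
      ultimately show ?thesis using oT by blast
    qed
  qed
qed

lemma ext_field_chart: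
  assumes "c \<in> A" "x \<in> cimg c"
  shows "ext_field c K w (cinv c x) c = (if x \<in> K then w x else 0)"
  using assms by (simp add: ext_field_def cinv_in cmap_cinv tvec_of_self)

text \<open>Multiplying all \<open>w i\<close> by one bump function gives fields on all of \<open>M\<close> that agree with the \<open>w i\<close> on a
  common ball. Connections, brackets and frames are only defined for global fields, so this is how
  local constructions reach them.\<close>

lemma local_vector_field_extends:
  assumes c: "c \<in> A" and S: "open S" "S \<subseteq> cimg c" "x \<in> S" and w: "\<And>i::'i. smooth_on S (w i)"
  obtains X r where "r > 0" "ball x r \<subseteq> S" "\<And>i. vector_field A (X i)"
    "\<And>i y. y \<in> ball x r \<Longrightarrow> X i (cinv c y) c = w i y"
proof -
  obtain \<beta> :: "real ^ 'n \<Rightarrow> real" and r K where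
    \<beta>: "smooth_on UNIV \<beta>" "r > 0" "compact K" "K \<subseteq> S"
      "ball x r \<subseteq> K" "\<And>y. y \<in> ball x r \<Longrightarrow> \<beta> y = 1" "\<And>y. y \<notin> K \<Longrightarrow> \<beta> y = 0"
    using bump_function_exists[OF S(1,3)] by metis
  define X where "X i = ext_field c K (\<lambda>y. \<beta> y *\<^sub>R w i y)" for i
  show thesis
  proof (rule that[of r X])
    show "vector_field A (X i)" for i
      unfolding X_def
      by (rule vector_field_ext_field[OF c S(1,2) \<beta>(3,4)])
        (auto intro!: smooth_on_scaleR S smooth_on_subset[OF \<beta>(1)] w \<beta>(7))
    fix i y assume y: "y \<in> ball x r"
    moreover have "y \<in> cimg c" using y \<beta> S(2) by blast
    ultimately show "X i (cinv c y) c = w i y"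
      unfolding X_def using \<beta>(5,6) by (subst ext_field_chart[OF c]) auto
  qed (use \<beta> in auto)
qed

end

section \<open>The Levi-Civita connection in terms of charts and frames\<close>

lemma bounded_bilinear_matrix_vector_mult:
  "bounded_bilinear (\<lambda>(B :: real ^ 'n ^ 'm) v. B *v v)"
  by (subst bilinear_conv_bounded_bilinear[symmetric])
    (auto simp: bilinear_def intro!: linearI
      simp: matrix_vector_mult_add_rdistrib matrix_vector_right_distrib scaleR_matrix_vector_assoc matrix_vector_mult_scaleR)

locale levi_civita_manifold = manifold M A
  for M :: "'a topology" and A :: "('a, 'n::finite) chart set" +
  fixes g :: "('a, 'n) metric" and nabla :: "('a, 'n) vfield \<Rightarrow> ('a, 'n) vfield \<Rightarrow> ('a, 'n) vfield"
  assumes metric: "lorentzian_metric M A g" and connection: "levi_civita M A g nabla"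
begin

definition rep :: "('a, 'n) chart \<Rightarrow> ('a, 'n) vfield \<Rightarrow> real ^ 'n \<Rightarrow> real ^ 'n" where
  "rep c X x = X (cinv c x) c"

abbreviation gram :: "('a, 'n) chart \<Rightarrow> real ^ 'n \<Rightarrow> real ^ 'n ^ 'n" where
  "gram \<equiv> metric_matrix A g"

lemma cinv_in_M: "c \<in> A \<Longrightarrow> x \<in> cimg c \<Longrightarrow> cinv c x \<in> topspace M"
  by (rule subsetD[OF cdom_subset cinv_in])

lemma smooth_rep: "vector_field A X \<Longrightarrow> c \<in> A \<Longrightarrow> smooth_on (cimg c) (rep c X)"
  unfolding rep_def[abs_def] by (rule vector_field_smooth)

lemma metric_sym:
  "p \<in> topspace M \<Longrightarrow> v \<in> tangent_space A p \<Longrightarrow> w \<in> tangent_space A p \<Longrightarrow> g p v w = g p w v"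
  using metric unfolding lorentzian_metric_def by blast

lemma metric_linear:
  "p \<in> topspace M \<Longrightarrow> u \<in> tangent_space A p \<Longrightarrow> v \<in> tangent_space A p \<Longrightarrow> w \<in> tangent_space A p
    \<Longrightarrow> g p (\<lambda>c. a *\<^sub>R u c + b *\<^sub>R v c) w = a * g p u w + b * g p v w"
  using metric unfolding lorentzian_metric_def by blast

lemma metric_sum:
  assumes p: "p \<in> topspace M" and e: "\<And>i. e i \<in> tangent_space A p" and w: "w \<in> tangent_space A p"
    and I: "finite I"
  shows "(\<lambda>c. \<Sum>i\<in>I. a i *\<^sub>R e i c) \<in> tangent_space A p \<and>
    g p (\<lambda>c. \<Sum>i\<in>I. a i *\<^sub>R e i c) w = (\<Sum>i\<in>I. a i * g p (e i) w)"
  using I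
proof induction
  case empty
  then show ?case
    using metric_linear[OF p tangent_zero tangent_zero w, of 0 0] by (simp add: tangent_zero)
next
  case (insert j I)
  then show ?case
    using tangent_comb[OF e[of j], of "\<lambda>c. \<Sum>i\<in>I. a i *\<^sub>R e i c" "a j" 1]
      metric_linear[OF p e[of j] _ w, of "\<lambda>c. \<Sum>i\<in>I. a i *\<^sub>R e i c" "a j" 1] by simp
qed

text \<open>Expand both tangent vectors in the coordinate vectors of the chart.\<close>

lemma metric_gram:
  assumes c: "c \<in> A" and x: "x \<in> cimg c"
    and v: "v \<in> tangent_space A (cinv c x)" and w: "w \<in> tangent_space A (cinv c x)"
  shows "g (cinv c x) v w = v c \<bullet> (gram c x *v w c)"
proof -
  define p where "p = cinv c x"
  have p: "p \<in> topspace M" "p \<in> cdom c" using cinv_in_M[OF c x] cinv_in[OF x] by (simp_all add: p_def)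
  define e where "e i = tvec_of A c p (axis i 1)" for i :: 'n
  have e: "e i \<in> tangent_space A p" for i unfolding e_def by (rule tvec_of_in[OF c p(2)])
  have eq: "u = (\<lambda>c'. \<Sum>i\<in>UNIV. (u c $ i) *\<^sub>R e i c')" if u: "u \<in> tangent_space A p" for u
  proof (rule tangent_eqI[OF u _ c p(2)])
    show "(\<lambda>c'. \<Sum>i\<in>UNIV. (u c $ i) *\<^sub>R e i c') \<in> tangent_space A p"
      using metric_sum[where e=e, OF p(1) e u finite] by blast
    show "u c = (\<Sum>i\<in>UNIV. (u c $ i) *\<^sub>R e i c)"
      unfolding e_def tvec_of_self[OF c p(2)] by (rule vec_eq_sum_axis)
  qed
  have G: "gram c x $ i $ j = g p (e i) (e j)" for i j
    by (simp add: metric_matrix_def p_def e_def Let_def)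
  have ex: "g p u y = (\<Sum>i\<in>UNIV. u c $ i * g p (e i) y)"
    if u: "u \<in> tangent_space A p" and y: "y \<in> tangent_space A p" for u y
  proof -
    have "g p u y = g p (\<lambda>c'. \<Sum>i\<in>UNIV. (u c $ i) *\<^sub>R e i c') y"
      by (rule arg_cong[OF eq[OF u], of "\<lambda>u. g p u y"])
    then show ?thesis
      using metric_sum[where e=e and a="\<lambda>i. u c $ i", OF p(1) e y finite] by simp
  qed
  have v': "v \<in> tangent_space A p" and w': "w \<in> tangent_space A p" using v w by (simp_all add: p_def)
  have "g p v w = (\<Sum>i\<in>UNIV. v c $ i * g p w (e i))"
    unfolding ex[OF v' w'] using metric_sym[OF p(1) e w'] by simp
  also have "\<dots> = (\<Sum>i\<in>UNIV. v c $ i * (\<Sum>j\<in>UNIV. w c $ j * g p (e i) (e j)))"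
    using metric_sym[OF p(1) e e] by (simp add: ex[OF w' e])
  finally show ?thesis
    by (simp add: G inner_vec_def matrix_vector_mult_def mult.commute p_def[symmetric])
qed

lemma vf_inner_chart:
  assumes "c \<in> A" "x \<in> cimg c" "vector_field A X" "vector_field A Y"
  shows "vf_inner g X Y (cinv c x) = rep c X x \<bullet> (gram c x *v rep c Y x)"
  using metric_gram[OF assms(1,2)] vector_field_tangent assms(3,4) by (simp add: vf_inner_def rep_def)

lemma gram_symmetric:
  assumes "c \<in> A" "x \<in> cimg c"
  shows "transpose (gram c x) = gram c x"
  using metric_sym[OF cinv_in_M[OF assms] tvec_of_in[OF assms(1) cinv_in[OF assms(2)]]
      tvec_of_in[OF assms(1) cinv_in[OF assms(2)]]]
  by (simp add: vec_eq_iff transpose_def metric_matrix_def Let_def)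

lemma smooth_gram:
  assumes "c \<in> A"
  shows "smooth_on (cimg c) (gram c)"
  by (intro smooth_on_vec open_cimg assms) (use metric assms in \<open>simp add: lorentzian_metric_def\<close>)

lemma orthonormal_family_at:
  assumes "c \<in> A" "x \<in> cimg c"
  obtains e \<epsilon> k where "orthonormal_family (gram c x) e \<epsilon>" "\<And>i. \<epsilon> i = (if i = k then -1 else 1)"
proof -
  obtain e :: "'n \<Rightarrow> ('a, 'n) tvec" and k where e: "\<And>i. e i \<in> tangent_space A (cinv c x)"
    "\<And>i j. g (cinv c x) (e i) (e j) = (if i \<noteq> j then 0 else if i = k then -1 else 1)"
    using metric cinv_in_M[OF assms] unfolding lorentzian_metric_def by blast
  show thesis
    by (rule that[of "\<lambda>i. e i c" "\<lambda>i. if i = k then -1 else 1" k])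
      (use e metric_gram[OF assms] in \<open>auto simp: orthonormal_family_def\<close>)
qed

text \<open>The definition of \<open>vf_apply\<close> picks some chart; the chain rule transports the derivative to the
  chart at hand.\<close>

lemma vf_apply_chart:
  assumes c: "c \<in> A" "x \<in> cimg c" and X: "vector_field A X"
    and f: "((f \<circ> cinv c) has_derivative f') (at x)"
  shows "vf_apply A X f (cinv c x) = f' (rep c X x)"
proof -
  define p where "p = cinv c x"
  have p: "p \<in> cdom c" "cmap c p = x" using c by (auto simp: p_def intro: cinv_in cmap_cinv)
  define c' where "c' = (SOME c'. c' \<in> charts_at A p)"
  have "c' \<in> charts_at A p" unfolding c'_def using charts_atI[OF c(1) p(1)] by (rule someI)
  then have c': "c' \<in> A" "p \<in> cdom c'" by (auto simp: charts_at_def)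
  have t: "(transition c' c has_derivative dtrans c' c p) (at (cmap c' p))"
    by (rule has_derivative_transition) (use c c' p in auto)
  have f1: "((f \<circ> cinv c) has_derivative f') (at (transition c' c (cmap c' p)))"
    using f p c' by (simp add: transition_cmap)
  have "((f \<circ> cinv c \<circ> transition c' c) has_derivative f' \<circ> dtrans c' c p) (at (cmap c' p))"
    using diff_chain_at[OF t f1] .
  then have "((f \<circ> cinv c') has_derivative f' \<circ> dtrans c' c p) (at (cmap c' p))"
    by (rule has_derivative_transform_within_open[where s="cmap c' ` (cdom c' \<inter> cdom c)"])
      (use c c' p open_cmap_image[OF c'(1) openin_cdom[OF c(1)]] in \<open>auto simp: transition_def cinv_cmap\<close>)
  then have "frechet_derivative (f \<circ> cinv c') (at (cmap c' p)) = f' \<circ> dtrans c' c p"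
    using frechet_derivative_at by metis
  moreover have "dtrans c' c p (X p c') = X p c"
    using tangent_trans[OF vector_field_tangent[OF X]] charts_atI c c' p by metis
  ultimately show ?thesis
    unfolding vf_apply_def p_def[symmetric] c'_def[symmetric] Let_def rep_def by simp
qed

definition drep :: "('a, 'n) chart \<Rightarrow> ('a, 'n) vfield \<Rightarrow> real ^ 'n \<Rightarrow> real ^ 'n \<Rightarrow> real ^ 'n" where
  "drep c X x = frechet_derivative (rep c X) (at x)"

definition dgram :: "('a, 'n) chart \<Rightarrow> real ^ 'n \<Rightarrow> real ^ 'n \<Rightarrow> real ^ 'n ^ 'n" where
  "dgram c x = frechet_derivative (gram c) (at x)"

lemma has_derivative_rep:
  "vector_field A X \<Longrightarrow> c \<in> A \<Longrightarrow> x \<in> cimg c \<Longrightarrow> (rep c X has_derivative drep c X x) (at x)"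
  unfolding drep_def by (rule smooth_on_has_derivative[OF smooth_rep])

lemma has_derivative_gram:
  "c \<in> A \<Longrightarrow> x \<in> cimg c \<Longrightarrow> (gram c has_derivative dgram c x) (at x)"
  unfolding dgram_def by (rule smooth_on_has_derivative[OF smooth_gram])

lemma vf_apply_inner_chart:
  assumes c: "c \<in> A" "x \<in> cimg c" and X: "vector_field A X" and Y: "vector_field A Y" "vector_field A Z"
  shows "vf_apply A X (vf_inner g Y Z) (cinv c x) =
    rep c Y x \<bullet> (gram c x *v drep c Z x (rep c X x) + dgram c x (rep c X x) *v rep c Z x)
    + drep c Y x (rep c X x) \<bullet> (gram c x *v rep c Z x)"
proof -
  have "((\<lambda>y. rep c Y y \<bullet> (gram c y *v rep c Z y)) has_derivative
      (\<lambda>v. rep c Y x \<bullet> (gram c x *v drep c Z x v + dgram c x v *v rep c Z x)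
        + drep c Y x v \<bullet> (gram c x *v rep c Z x))) (at x)"
    by (intro has_derivative_inner has_derivative_rep Y c
        bounded_bilinear.FDERIV[OF bounded_bilinear_matrix_vector_mult] has_derivative_gram)
  then have "((vf_inner g Y Z \<circ> cinv c) has_derivative
      (\<lambda>v. rep c Y x \<bullet> (gram c x *v drep c Z x v + dgram c x v *v rep c Z x)
        + drep c Y x v \<bullet> (gram c x *v rep c Z x))) (at x)"
    by (rule has_derivative_transform_within_open[OF _ open_cimg[OF c(1)] c(2)])
      (simp add: vf_inner_chart[OF c(1) _ Y])
  from vf_apply_chart[OF c X this] show ?thesis .
qed

lemma lie_bracket_chart:
  assumes c: "c \<in> A" "x \<in> cimg c"
  shows "lie_bracket A X Y (cinv c x) c = drep c Y x (rep c X x) - drep c X x (rep c Y x)"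
  using charts_atI[OF c(1) cinv_in[OF c(2)]]
  by (simp add: lie_bracket_def drep_def rep_def[abs_def] cmap_cinv[OF c(2)])

lemma vector_field_nabla: "vector_field A X \<Longrightarrow> vector_field A Y \<Longrightarrow> vector_field A (nabla X Y)"
  using connection by (simp add: levi_civita_def affine_connection_def)

lemma nabla_vf_add:
  "vector_field A X \<Longrightarrow> vector_field A Y \<Longrightarrow> vector_field A Z \<Longrightarrow>
    nabla X (vf_add Y Z) = vf_add (nabla X Y) (nabla X Z)"
  using connection by (simp add: levi_civita_def affine_connection_def)

lemma torsion_free:
  "vector_field A X \<Longrightarrow> vector_field A Y \<Longrightarrow> lie_bracket A X Y = vf_diff (nabla X Y) (nabla Y X)"
  using connection unfolding levi_civita_def by metis

lemma metric_compatible: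
  "vector_field A X \<Longrightarrow> vector_field A Y \<Longrightarrow> vector_field A Z \<Longrightarrow> p \<in> topspace M \<Longrightarrow>
    vf_apply A X (vf_inner g Y Z) p = vf_inner g (nabla X Y) Z p + vf_inner g Y (nabla X Z) p"
  using connection unfolding levi_civita_def by blast

lemma vector_field_lie_bracket:
  "vector_field A X \<Longrightarrow> vector_field A Y \<Longrightarrow> vector_field A (lie_bracket A X Y)"
  by (simp add: torsion_free vector_field_diff vector_field_nabla)

lemma vf_inner_sym:
  "vector_field A X \<Longrightarrow> vector_field A Y \<Longrightarrow> p \<in> topspace M \<Longrightarrow> vf_inner g X Y p = vf_inner g Y X p"
  unfolding vf_inner_def by (intro metric_sym vector_field_tangent)

lemma vf_inner_comb:
  assumes "vector_field A X" "vector_field A Y" "vector_field A Z" "p \<in> topspace M"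
  shows "vf_inner g (vf_diff X Y) Z p = vf_inner g X Z p - vf_inner g Y Z p"
    "vf_inner g (vf_add X Y) Z p = vf_inner g X Z p + vf_inner g Y Z p"
  using metric_linear[OF assms(4) vector_field_tangent[OF assms(1)] vector_field_tangent[OF assms(2)]
      vector_field_tangent[OF assms(3)], of 1 "-1"]
    metric_linear[OF assms(4) vector_field_tangent[OF assms(1)] vector_field_tangent[OF assms(2)]
      vector_field_tangent[OF assms(3)], of 1 1]
  by (simp_all add: vf_inner_def vf_diff_def vf_add_def)

lemma vf_inner_comb':
  assumes "vector_field A X" "vector_field A Y" "vector_field A Z" "p \<in> topspace M"
  shows "vf_inner g Z (vf_diff X Y) p = vf_inner g Z X p - vf_inner g Z Y p"
  using vf_inner_comb(1)[OF assms] assms by (simp add: vf_inner_sym vector_field_diff)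

text \<open>Since the torsion vanishes, \<open>\<nabla>\<^sub>E Y = \<nabla>\<^sub>Y E + [E,Y]\<close>, and \<open>g(\<nabla>\<^sub>Y E, E)\<close> is half the derivative of
  \<open>g(E,E)\<close> along \<open>Y\<close>. In the sum the derivatives of \<open>E\<close> cancel. This replaces the Christoffel
  symbols in the computation of the divergence.\<close>

lemma inner_nabla_self_chart:
  assumes c: "c \<in> A" "x \<in> cimg c" and E: "vector_field A E" and Y: "vector_field A Y"
  shows "vf_inner g (nabla E Y) E (cinv c x) =
    (rep c E x \<bullet> (dgram c x (rep c Y x) *v rep c E x)) / 2 + rep c E x \<bullet> (gram c x *v drep c Y x (rep c E x))"
proof -
  let ?p = "cinv c x"
  note p = cinv_in_M[OF c]
  note V = vector_field_nabla[OF E Y] vector_field_nabla[OF Y E] vector_field_lie_bracket[OF E Y]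
  note sym = symmetric_matrix_inner[OF gram_symmetric[OF c]]
  have "vf_apply A Y (vf_inner g E E) ?p = 2 * vf_inner g (nabla Y E) E ?p"
    using metric_compatible[OF Y E E p] vf_inner_sym[OF V(2) E p] by simp
  moreover have "vf_inner g (lie_bracket A E Y) E ?p = vf_inner g (nabla E Y) E ?p - vf_inner g (nabla Y E) E ?p"
    unfolding torsion_free[OF E Y] by (rule vf_inner_comb(1)[OF V(1,2) E p])
  moreover have "vf_inner g (lie_bracket A E Y) E ?p =
      rep c E x \<bullet> (gram c x *v drep c Y x (rep c E x)) - rep c E x \<bullet> (gram c x *v drep c E x (rep c Y x))"
    unfolding vf_inner_chart[OF c V(3) E] rep_def[of c "lie_bracket A E Y"] lie_bracket_chart[OF c]
    by (subst sym) (simp add: matrix_vector_mult_diff_distrib inner_diff_right)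
  moreover have "vf_apply A Y (vf_inner g E E) ?p =
      rep c E x \<bullet> (dgram c x (rep c Y x) *v rep c E x) + 2 * (rep c E x \<bullet> (gram c x *v drep c E x (rep c Y x)))"
    unfolding vf_apply_inner_chart[OF c Y E E] sym[of "drep c E x (rep c Y x)"]
    by (simp add: inner_add_right)
  ultimately show ?thesis by simp
qed

section \<open>Killing fields\<close>

context
  fixes U assumes killing: "killing_field M A g U"
begin

lemma killing_vector_field: "vector_field A U"
  using killing by (simp add: killing_field_def)

text \<open>Killing's equation, once the Lie derivative is rewritten by compatibility with the metric and
  vanishing torsion.\<close>

lemma nabla_killing_skew:
  assumes X: "vector_field A X" and Y: "vector_field A Y" and p: "p \<in> topspace M"
  shows "vf_inner g (nabla X U) Y p = - vf_inner g X (nabla Y U) p"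
proof -
  note U = killing_vector_field
  note V = vector_field_nabla[OF U X] vector_field_nabla[OF X U] vector_field_nabla[OF U Y] vector_field_nabla[OF Y U]
  have "vf_apply A U (vf_inner g X Y) p
      - vf_inner g (lie_bracket A U X) Y p - vf_inner g X (lie_bracket A U Y) p = 0"
    using killing X Y p by (simp add: killing_field_def)
  then show ?thesis
    unfolding metric_compatible[OF U X Y p] torsion_free[OF U X] torsion_free[OF U Y]
      vf_inner_comb(1)[OF V(1,2) Y p] vf_inner_comb'[OF V(3,4) X p] by simp
qed

text \<open>Write \<open>V = \<nabla>\<^sub>E U\<close>, \<open>W = \<nabla>\<^sub>U E\<close> and \<open>B = [E,U] = V - W\<close>. By skewness \<open>g(V,E) = 0\<close> everywhere, so
  differentiating along \<open>U\<close> gives \<open>g(\<nabla>\<^sub>U V, E) = - g(V,W)\<close>; and again by skewness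
  \<open>g(\<nabla>\<^sub>B U, E) = - g(B,V) = - g(V,V) + g(V,W)\<close>. The terms \<open>g(V,W)\<close> cancel in the curvature.\<close>

lemma inner_curvature_killing:
  assumes E: "vector_field A E" and p: "p \<in> topspace M"
  shows "vf_inner g (curvature A nabla E U U) E p
    = vf_inner g (nabla E (nabla U U)) E p + vf_inner g (nabla E U) (nabla E U) p"
proof -
  note U = killing_vector_field
  define V where "V = nabla E U"
  define W where "W = nabla U E"
  define B where "B = lie_bracket A E U"
  have V: "vector_field A V" and W: "vector_field A W" and UU: "vector_field A (nabla U U)"
    and B: "vector_field A B"
    unfolding V_def W_def B_def by (intro vector_field_nabla vector_field_lie_bracket U E)+
  have B_eq: "B = vf_diff V W"
    unfolding V_def W_def B_def by (rule torsion_free[OF E U])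
  note N = vector_field_nabla[OF E UU] vector_field_nabla[OF U V] vector_field_nabla[OF B U]
  have zero: "vf_inner g V E q = 0" if "q \<in> topspace M" for q
    using nabla_killing_skew[OF E E that] vf_inner_sym[OF V E that] by (simp add: V_def)
  obtain c where c: "c \<in> A" "p \<in> cdom c" using ex_chart[OF p] by blast
  define x where "x = cmap c p"
  have x: "x \<in> cimg c" "cinv c x = p" using c by (auto simp: x_def cinv_cmap)
  \<comment> \<open>\<open>g(V,E)\<close> is the zero function, so its derivative along \<open>U\<close> vanishes\<close>
  have "((\<lambda>_. 0) has_derivative (\<lambda>_. 0::real)) (at x)" by simp
  then have "((vf_inner g V E \<circ> cinv c) has_derivative (\<lambda>_. 0)) (at x)"
    by (rule has_derivative_transform_within_open[OF _ open_cimg[OF c(1)] x(1)])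
      (simp add: zero cinv_in_M[OF c(1)])
  from vf_apply_chart[OF c(1) x(1) U this] have "vf_apply A U (vf_inner g V E) p = 0"
    by (simp add: x)
  then have 1: "vf_inner g (nabla U V) E p = - vf_inner g V W p"
    using metric_compatible[OF U V E p] by (simp add: W_def)
  have 2: "vf_inner g (nabla B U) E p = - (vf_inner g V V p - vf_inner g V W p)"
    using nabla_killing_skew[OF B E p] vf_inner_sym[OF B V p] vf_inner_comb'[OF V W V p]
    by (simp add: V_def[symmetric]) (simp add: B_eq)
  have "vf_inner g (curvature A nabla E U U) E p =
      vf_inner g (nabla E (nabla U U)) E p - vf_inner g (nabla U V) E p - vf_inner g (nabla B U) E p"
    unfolding curvature_def V_def[symmetric] B_def[symmetric]
    by (simp add: vf_inner_comb(1) vector_field_diff N E p)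
  then show ?thesis unfolding 1 2 by (simp add: V_def)
qed

text \<open>The skew form \<open>g(\<nabla>\<^sub>X U, Y)\<close> is half the exterior derivative of the one-form \<open>g(U,\<cdot>)\<close>. In a chart,
  with \<open>\<alpha>\<close> the derivative of the coefficients \<open>G U\<close> of this one-form, it is
  \<open>(\<alpha>(X) \<bullet> Y - \<alpha>(Y) \<bullet> X) / 2\<close>. So its value at a point is a bilinear function of the values of \<open>X\<close>
  and \<open>Y\<close> there.\<close>

lemma inner_nabla_killing_chart:
  assumes c: "c \<in> A" "x \<in> cimg c"
  obtains F :: "real ^ 'n ^ 'n" where "\<And>v w. v \<bullet> (F *v w) = - (w \<bullet> (F *v v))"
    "\<And>X Y. vector_field A X \<Longrightarrow> vector_field A Y \<Longrightarrow>
       vf_inner g (nabla X U) Y (cinv c x) = rep c X x \<bullet> (F *v rep c Y x)"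
proof -
  note U = killing_vector_field
  define \<alpha> where "\<alpha> v = gram c x *v drep c U x v + dgram c x v *v rep c U x" for v
  have "((\<lambda>y. gram c y *v rep c U y) has_derivative \<alpha>) (at x)"
    unfolding \<alpha>_def
    by (intro bounded_bilinear.FDERIV[OF bounded_bilinear_matrix_vector_mult] has_derivative_gram
        has_derivative_rep U c)
  then have \<alpha>_lin: "linear \<alpha>" by (rule has_derivative_linear)
  \<comment> \<open>twice the form is given by the skew part of the Jacobian matrix of \<open>G U\<close>\<close>
  define J where "J = matrix \<alpha>"
  have J: "J *v v = \<alpha> v" for v
    unfolding J_def using \<alpha>_lin by (simp add: matrix_works)
  define F where "F = (1/2) *\<^sub>R (transpose J - J)"
  have F: "v \<bullet> (F *v w) = (\<alpha> v \<bullet> w - \<alpha> w \<bullet> v) / 2" for v w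
  proof -
    have "v \<bullet> (transpose J *v w) = \<alpha> v \<bullet> w"
      by (metis J dot_lmul_matrix inner_commute transpose_matrix_vector)
    then show ?thesis
      unfolding F_def by (simp add: scaleR_matrix_vector_assoc[symmetric] matrix_vector_mult_diff_rdistrib
          inner_diff_right J inner_commute del: transpose_matrix_vector)
  qed
  show thesis
  proof (rule that[of F])
    show "v \<bullet> (F *v w) = - (w \<bullet> (F *v v))" for v w
      unfolding F by (simp add: field_simps)
    fix X Y assume X: "vector_field A X" and Y: "vector_field A Y"
    let ?p = "cinv c x"
    note p = cinv_in_M[OF c]
    note V = vector_field_nabla[OF X U] vector_field_nabla[OF Y U] vector_field_nabla[OF X Y] vector_field_nabla[OF Y X]
    note sym = symmetric_matrix_inner[OF gram_symmetric[OF c]]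
    have ap: "vf_apply A V (vf_inner g W U) ?p = rep c W x \<bullet> \<alpha> (rep c V x) + drep c W x (rep c V x) \<bullet> (gram c x *v rep c U x)"
      if "vector_field A V" "vector_field A W" for V W
      using vf_apply_inner_chart[OF c that(1,2) U] by (simp add: \<alpha>_def)
    have "vf_inner g (lie_bracket A X Y) U ?p = vf_inner g (nabla X Y) U ?p - vf_inner g (nabla Y X) U ?p"
      unfolding torsion_free[OF X Y] by (rule vf_inner_comb(1)[OF V(3,4) U p])
    moreover have "vf_inner g (lie_bracket A X Y) U ?p =
      (drep c Y x (rep c X x) - drep c X x (rep c Y x)) \<bullet> (gram c x *v rep c U x)"
      unfolding vf_inner_chart[OF c vector_field_lie_bracket[OF X Y] U]
      by (simp add: rep_def[of c "lie_bracket A X Y"] lie_bracket_chart[OF c])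
    moreover have "vf_inner g (nabla X U) Y ?p = - vf_inner g X (nabla Y U) ?p"
      by (rule nabla_killing_skew[OF X Y p])
    ultimately show "vf_inner g (nabla X U) Y ?p = rep c X x \<bullet> (F *v rep c Y x)"
      using metric_compatible[OF X Y U p] metric_compatible[OF Y X U p] ap[OF X Y] ap[OF Y X]
        vf_inner_sym[OF V(1) Y p]
      unfolding F by (simp add: inner_diff_left inner_commute[of "\<alpha> _"])
  qed
qed

text \<open>By Parseval's identity in the given orthonormal basis, the right hand side is the signed double sum
  of the squares of the entries of the skew form, to which the algebraic inequality applies.\<close>

lemma sum_inner_nabla_killing_ge:
  assumes c: "c \<in> A" "x \<in> cimg c" and E: "\<And>i. vector_field A (E i)"
    and on: "orthonormal_family (gram c x) (\<lambda>i. rep c (E i) x) \<delta>"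
    and U: "vf_inner g U U (cinv c x) < 0"
  shows "2 / vf_inner g U U (cinv c x) * vf_inner g (nabla U U) (nabla U U) (cinv c x)
    \<le> (\<Sum>i\<in>UNIV. \<delta> i * vf_inner g (nabla (E i) U) (nabla (E i) U) (cinv c x))"
proof -
  let ?p = "cinv c x"
  let ?e = "\<lambda>i. rep c (E i) x" and ?G = "gram c x"
  note vU = killing_vector_field
  obtain F where F: "\<And>v w. v \<bullet> (F *v w) = - (w \<bullet> (F *v v))"
    "\<And>X Y. vector_field A X \<Longrightarrow> vector_field A Y \<Longrightarrow>
       vf_inner g (nabla X U) Y ?p = rep c X x \<bullet> (F *v rep c Y x)"
    using inner_nabla_killing_chart[OF c] by metis
  obtain e \<epsilon> k where e: "orthonormal_family ?G e \<epsilon>" "\<And>i. \<epsilon> i = (if i = k then -1 else 1)"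
    using orthonormal_family_at[OF c] by metis
  note sym = symmetric_matrix_inner[OF gram_symmetric[OF c]]
  have Z: "rep c (nabla U U) x \<bullet> (?G *v w) = rep c U x \<bullet> (F *v w)" for w
  proof -
    have 1: "rep c (nabla U U) x \<bullet> (?G *v ?e i) = rep c U x \<bullet> (F *v ?e i)" for i
      using F(2)[OF vU E] vf_inner_chart[OF c vector_field_nabla[OF vU vU] E] by metis
    have "w = (inverse_gram ?e \<delta> ** ?G) *v w"
      by (simp add: inverse_gram_inverse[OF on])
    also have "\<dots> = (\<Sum>i\<in>UNIV. (\<delta> i * (?e i \<bullet> (?G *v w))) *\<^sub>R ?e i)"
      by (simp add: matrix_vector_mul_assoc[symmetric] inverse_gram_mult_vec)
    finally have w: "w = \<dots>" .
    show ?thesis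
      by (subst (1 2) w) (simp add: matrix_vector_mult_sum_scaleR inner_sum_right 1)
  qed
  have "vf_inner g (nabla (E i) U) (nabla (E i) U) ?p = (\<Sum>j\<in>UNIV. \<delta> j * (?e i \<bullet> (F *v ?e j))\<^sup>2)" for i
  proof -
    define V where "V = nabla (E i) U"
    have V: "vector_field A V" unfolding V_def by (rule vector_field_nabla[OF E vU])
    let ?a = "?G *v rep c V x"
    have "vf_inner g V V ?p = ?a \<bullet> ((inverse_gram ?e \<delta> ** ?G) *v rep c V x)"
      by (simp add: inverse_gram_inverse[OF on] vf_inner_chart[OF c V V] inner_commute)
    also have "\<dots> = (\<Sum>j\<in>UNIV. \<delta> j * (?a \<bullet> ?e j)\<^sup>2)"
      unfolding sum_square_inner_eq by (simp add: matrix_vector_mul_assoc)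
    also have "(\<lambda>j. ?a \<bullet> ?e j) = (\<lambda>j. ?e i \<bullet> (F *v ?e j))"
    proof
      fix j
      have "?a \<bullet> ?e j = vf_inner g V (E j) ?p"
        by (simp add: vf_inner_chart[OF c V E] sym[of "rep c V x"] inner_commute)
      then show "?a \<bullet> ?e j = ?e i \<bullet> (F *v ?e j)"
        unfolding V_def F(2)[OF E E] .
    qed
    finally show ?thesis by (simp add: V_def)
  qed
  then have "(\<Sum>i\<in>UNIV. \<delta> i * vf_inner g (nabla (E i) U) (nabla (E i) U) ?p)
      = (\<Sum>i\<in>UNIV. \<Sum>j\<in>UNIV. \<delta> i * \<delta> j * (?e i \<bullet> (F *v ?e j))\<^sup>2)"
    by (simp add: sum_distrib_left mult.assoc)
  moreover have "2 / (rep c U x \<bullet> (?G *v rep c U x)) * (rep c (nabla U U) x \<bullet> (?G *v rep c (nabla U U) x))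
      \<le> (\<Sum>i\<in>UNIV. \<Sum>j\<in>UNIV. \<delta> i * \<delta> j * (?e i \<bullet> (F *v ?e j))\<^sup>2)"
    by (rule lorentzian_skew_form_inequality[OF gram_symmetric[OF c] e on F(1) _ Z])
      (use U vf_inner_chart[OF c vU vU] in simp)
  ultimately show ?thesis
    by (simp add: vf_inner_chart[OF c] vU vector_field_nabla)
qed

end

end

section \<open>Local orthonormal frames\<close>

context levi_civita_manifold
begin

lemmas smooth_on_matrix_vector_mult =
  bounded_bilinear.smooth_on_prod[OF bounded_bilinear_matrix_vector_mult]

text \<open>Induction on the set of indices. Subtracting from the constant field \<open>e j\<close> its projections to the
  fields found so far changes nothing at \<open>x\<close>, where the family is already orthonormal. So the square
  \<open>q\<close> of the new field, taken with its sign, is \<open>1\<close> at \<open>x\<close> and stays positive nearby, and the field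
  can be normalised there. Starting from an orthonormal basis at \<open>x\<close> avoids the null vectors that
  obstruct the Gram-Schmidt process for an indefinite metric.\<close>

lemma local_gram_schmidt:
  assumes c: "c \<in> A" "x \<in> cimg c" and e: "orthonormal_family (gram c x) e \<epsilon>" and I: "finite I"
  shows "\<exists>T w. open T \<and> x \<in> T \<and> T \<subseteq> cimg c \<and> (\<forall>i\<in>I. smooth_on T (w i) \<and> w i x = e i) \<and>
    (\<forall>y\<in>T. \<forall>i\<in>I. \<forall>j\<in>I. w i y \<bullet> (gram c y *v w j y) = (if i = j then \<epsilon> i else 0))"
  using I
proof induction
  case empty
  then show ?case using c open_cimg[OF c(1)] by blast
next
  case (insert j I)
  then obtain T w where T: "open T" "x \<in> T" "T \<subseteq> cimg c"
    and w: "\<And>i. i \<in> I \<Longrightarrow> smooth_on T (w i)" "\<And>i. i \<in> I \<Longrightarrow> w i x = e i"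
    "\<And>y i k. y \<in> T \<Longrightarrow> i \<in> I \<Longrightarrow> k \<in> I \<Longrightarrow> w i y \<bullet> (gram c y *v w k y) = (if i = k then \<epsilon> i else 0)"
    by blast
  have eps2: "\<epsilon> i * \<epsilon> i = 1" for i
  proof -
    have "\<bar>\<epsilon> i\<bar> = 1" using e by (simp add: orthonormal_family_def)
    then show ?thesis by (metis abs_mult_self_eq mult_1)
  qed
  have ee: "e i \<bullet> (gram c x *v e k) = (if i = k then \<epsilon> i else 0)" for i k
    using e by (simp add: orthonormal_family_def)
  have sG: "smooth_on T (gram c)" by (rule smooth_on_subset[OF smooth_gram[OF c(1)] T(3)])
  define f where "f y = e j - (\<Sum>i\<in>I. (\<epsilon> i * (e j \<bullet> (gram c y *v w i y))) *\<^sub>R w i y)" for y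
  have f: "smooth_on T f"
    unfolding f_def
    by (intro smooth_on_diff smooth_on_const smooth_on_sum smooth_on_scaleR smooth_on_mult smooth_on_inner
        smooth_on_matrix_vector_mult sG w T(1))
  have fx: "f x = e j"
    using insert.hyps w(2) ee by (auto simp: f_def intro!: sum.neutral)
  have orth: "w i y \<bullet> (gram c y *v f y) = 0" if "i \<in> I" "y \<in> T" for i y
  proof -
    have "w i y \<bullet> (gram c y *v f y) = w i y \<bullet> (gram c y *v e j)
        - (\<Sum>k\<in>I. (\<epsilon> k * (e j \<bullet> (gram c y *v w k y))) * (w i y \<bullet> (gram c y *v w k y)))"
      by (simp add: f_def matrix_vector_mult_diff_distrib matrix_vector_mult_sum_scaleR inner_diff_right inner_sum_right)
    also have "(\<Sum>k\<in>I. (\<epsilon> k * (e j \<bullet> (gram c y *v w k y))) * (w i y \<bullet> (gram c y *v w k y)))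
        = (\<Sum>k\<in>I. if i = k then (\<epsilon> i * \<epsilon> i) * (e j \<bullet> (gram c y *v w i y)) else 0)"
      by (rule sum.cong) (use that w(3) in auto)
    also have "\<dots> = e j \<bullet> (gram c y *v w i y)"
      using that insert.hyps by (simp add: eps2)
    also have "\<dots> = w i y \<bullet> (gram c y *v e j)"
      using T(3) that by (intro symmetric_matrix_inner gram_symmetric c) auto
    finally show ?thesis by simp
  qed
  define q where "q y = \<epsilon> j * (f y \<bullet> (gram c y *v f y))" for y
  have q: "smooth_on T q"
    unfolding q_def
    by (intro smooth_on_mult smooth_on_const smooth_on_inner smooth_on_matrix_vector_mult sG f T(1))
  define T' where "T' = T \<inter> q -` {0<..}"
  have T': "open T'" "T' \<subseteq> T"
    unfolding T'_def using continuous_open_preimage[OF smooth_on_imp_continuous_on[OF q] T(1)] by auto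
  have qpos: "q y > 0" if "y \<in> T'" for y using that by (simp add: T'_def)
  have qx: "q x = 1" by (simp add: q_def fx ee eps2)
  define w' where "w' i = (if i = j then (\<lambda>y. (q y powr (-1/2)) *\<^sub>R f y) else w i)" for i
  have jI: "i \<noteq> j" if "i \<in> I" for i using that insert.hyps by auto
  show ?case
  proof (intro exI conjI ballI)
    show "open T'" "x \<in> T'" "T' \<subseteq> cimg c"
      using T' T qx by (auto simp: T'_def)
    fix i assume i: "i \<in> insert j I"
    show "smooth_on T' (w' i)"
    proof (cases "i = j")
      case True
      then show ?thesis unfolding w'_def
        by (auto intro!: smooth_on_scaleR smooth_on_powr smooth_on_subset[OF f] smooth_on_subset[OF q] T' qpos)
    next
      case False
      then show ?thesis using i w(1) smooth_on_subset T'(2) by (auto simp: w'_def)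
    qed
    show "w' i x = e i"
      using i w(2) by (auto simp: w'_def qx fx)
  next
    fix y i k assume y: "y \<in> T'" and i: "i \<in> insert j I" and k: "k \<in> insert j I"
    have yT: "y \<in> T" using y T' by blast
    then have yc: "y \<in> cimg c" using T by blast
    note sym = symmetric_matrix_inner[OF gram_symmetric[OF c(1) yc]]
    have jj: "w' j y \<bullet> (gram c y *v w' j y) = \<epsilon> j"
    proof -
      have "(q y powr (-1/2)) * (q y powr (-1/2)) = inverse (q y)"
        using qpos[OF y] powr_add[of "q y" "-1/2" "-1/2"] by (simp add: powr_minus)
      moreover have "f y \<bullet> (gram c y *v f y) = \<epsilon> j * q y"
        using eps2[of j] by (simp add: q_def mult.assoc[symmetric])
      ultimately show ?thesis
        using qpos[OF y] by (simp add: w'_def matrix_vector_mult_scaleR mult.assoc[symmetric])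
    qed
    have ij: "w' i y \<bullet> (gram c y *v w' j y) = 0" if "i \<in> I" for i
      using orth[OF that yT] jI[OF that] by (simp add: w'_def matrix_vector_mult_scaleR)
    have ji: "w' j y \<bullet> (gram c y *v w' i y) = 0" if "i \<in> I" for i
      using ij[OF that] sym by simp
    have ik: "w' i y \<bullet> (gram c y *v w' k y) = (if i = k then \<epsilon> i else 0)" if "i \<in> I" "k \<in> I" for i k
      using w(3)[OF yT that] jI[OF that(1)] jI[OF that(2)] by (simp add: w'_def)
    show "w' i y \<bullet> (gram c y *v w' k y) = (if i = k then \<epsilon> i else 0)"
      using i k jj ij ji ik by auto
  qed
qed

lemma orthonormal_frame_exists:
  assumes p: "p \<in> topspace M"
  shows "\<exists>E. orthonormal_frame_around M A g p E"
proof -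
  obtain c where c: "c \<in> A" "p \<in> cdom c" using ex_chart[OF p] by blast
  define x where "x = cmap c p"
  have x: "x \<in> cimg c" "cinv c x = p" using c by (auto simp: x_def cinv_cmap)
  obtain e \<epsilon> k where e: "orthonormal_family (gram c x) e \<epsilon>" "\<And>i. \<epsilon> i = (if i = k then -1 else 1)"
    using orthonormal_family_at[OF c(1) x(1)] by metis
  obtain T w where T: "open T" "x \<in> T" "T \<subseteq> cimg c" and w': "\<forall>i\<in>UNIV. smooth_on T (w i) \<and> w i x = e i"
    "\<forall>y\<in>T. \<forall>i\<in>UNIV. \<forall>j\<in>UNIV. w i y \<bullet> (gram c y *v w j y) = (if i = j then \<epsilon> i else 0)"
    using local_gram_schmidt[OF c(1) x(1) e(1) finite[of UNIV]] by (elim exE conjE)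
  from w' have w: "smooth_on T (w i)"
    "y \<in> T \<Longrightarrow> w i y \<bullet> (gram c y *v w j y) = (if i = j then \<epsilon> i else 0)" for i j y
    by auto
  obtain X r where X: "r > 0" "ball x r \<subseteq> T" "\<And>i. vector_field A (X i)"
    "\<And>i y. y \<in> ball x r \<Longrightarrow> X i (cinv c y) c = w i y"
    using local_vector_field_extends[where w=w, OF c(1) T(1,3,2) w(1)] by metis
  show ?thesis
    unfolding orthonormal_frame_around_def
  proof (intro exI conjI allI ballI)
    show "vector_field A (X i)" for i by (rule X)
    show "openin M {p \<in> cdom c. cmap c p \<in> ball x r}" by (rule openin_cmap_preimage[OF c(1) open_ball])
    show "p \<in> {p \<in> cdom c. cmap c p \<in> ball x r}" using c X by (simp add: x_def)
    fix q i j assume "q \<in> {p \<in> cdom c. cmap c p \<in> ball x r}"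
    then have q: "q \<in> cdom c" "cmap c q \<in> ball x r" by auto
    have "vf_inner g (X i) (X j) q = (if i = j then \<epsilon> i else 0)"
      using vf_inner_chart[OF c(1) imageI[OF q(1)] X(3) X(3), of i j] X(4)[OF q(2)] w(2)[of "cmap c q"] X(2) q
      by (auto simp: rep_def cinv_cmap[OF c(1)])
    then show "if i = j then \<bar>vf_inner g (X i) (X j) q\<bar> = 1 else vf_inner g (X i) (X j) q = 0"
      by (auto simp: e(2))
  qed
qed

text \<open>The frame that the definition of \<open>ricci\<close> chooses.\<close>

definition frame :: "'a \<Rightarrow> 'n \<Rightarrow> ('a, 'n) vfield" where
  "frame p = (SOME E. orthonormal_frame_around M A g p E)"

abbreviation sign_of :: "'a \<Rightarrow> 'n \<Rightarrow> real" where
  "sign_of p i \<equiv> vf_inner g (frame p i) (frame p i) p"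

lemma frame_around:
  "p \<in> topspace M \<Longrightarrow> orthonormal_frame_around M A g p (frame p)"
  unfolding frame_def by (rule someI_ex[OF orthonormal_frame_exists])

lemma vector_field_frame: "p \<in> topspace M \<Longrightarrow> vector_field A (frame p i)"
  using frame_around by (simp add: orthonormal_frame_around_def)

lemma frame_orthonormal:
  assumes c: "c \<in> A" "x \<in> cimg c" and p: "p = cinv c x"
  shows "orthonormal_family (gram c x) (\<lambda>i. rep c (frame p i) x) (sign_of p)"
proof -
  have pM: "p \<in> topspace M" using cinv_in_M[OF c] p by simp
  have "\<forall>i j. if i = j then \<bar>vf_inner g (frame p i) (frame p j) p\<bar> = 1 else vf_inner g (frame p i) (frame p j) p = 0"
    using frame_around[OF pM] unfolding orthonormal_frame_around_def by blast
  then have "\<bar>sign_of p i\<bar> = 1"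
    "vf_inner g (frame p i) (frame p j) p = (if i = j then sign_of p i else 0)" for i j
    by metis+
  moreover have "vf_inner g (frame p i) (frame p j) p = rep c (frame p i) x \<bullet> (gram c x *v rep c (frame p j) x)" for i j
    using vf_inner_chart[OF c vector_field_frame[OF pM] vector_field_frame[OF pM], of i j]
    unfolding p[symmetric] .
  ultimately show ?thesis
    unfolding orthonormal_family_def by metis
qed

section \<open>The divergence of a vector field\<close>

text \<open>The trace of \<open>X \<mapsto> \<nabla>\<^sub>X Y\<close>, computed in the same frame as \<open>ricci\<close>, so that the two can be compared
  term by term.\<close>

definition divergence :: "('a, 'n) vfield \<Rightarrow> 'a \<Rightarrow> real" where
  "divergence Y p = (\<Sum>i\<in>UNIV. sign_of p i * vf_inner g (nabla (frame p i) Y) (frame p i) p)"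

definition vol_density :: "('a, 'n) chart \<Rightarrow> real ^ 'n \<Rightarrow> real" where
  "vol_density c x = sqrt \<bar>det (gram c x)\<bar>"

lemma det_gram_nonzero:
  assumes "c \<in> A" "x \<in> cimg c"
  shows "det (gram c x) \<noteq> 0"
proof -
  obtain e \<epsilon> k where "orthonormal_family (gram c x) e \<epsilon>" "\<And>i. \<epsilon> i = (if i = k then -1 else 1)"
    using orthonormal_family_at[OF assms] by metis
  from inverse_gram_inverse(1)[OF this(1)] have "det (inverse_gram e \<epsilon>) * det (gram c x) = 1"
    by (metis det_mul det_I)
  then show ?thesis by auto
qed

lemma vol_density_pos: "c \<in> A \<Longrightarrow> x \<in> cimg c \<Longrightarrow> vol_density c x > 0"
  by (simp add: vol_density_def det_gram_nonzero)

lemma vol_density_power4: "vol_density c x ^ 4 = (det (gram c x))\<^sup>2"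
proof -
  have "vol_density c x ^ 4 = ((vol_density c x)\<^sup>2)\<^sup>2" by simp
  then show ?thesis by (simp add: vol_density_def)
qed

lemma smooth_det_gram:
  assumes c: "c \<in> A"
  shows "smooth_on (cimg c) (\<lambda>x. det (gram c x))"
  unfolding det_def
  by (intro smooth_on_sum smooth_on_mult smooth_on_prod_fun smooth_on_const smooth_on_vec_nth
      smooth_gram open_cimg c)

text \<open>The determinant has no zeros, so its square is positive, and the density is the fourth root of it.\<close>

lemma smooth_vol_density:
  assumes c: "c \<in> A"
  shows "smooth_on (cimg c) (vol_density c)"
proof (rule smooth_on_cong_imp[OF open_cimg[OF c]])
  show "smooth_on (cimg c) (\<lambda>x. (det (gram c x) * det (gram c x)) powr (1/4))"
    by (intro smooth_on_powr smooth_on_mult smooth_det_gram open_cimg c)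
      (use det_gram_nonzero[OF c] in \<open>simp add: zero_less_mult_iff\<close>, use not_less_iff_gr_or_eq in blast)
  fix x assume x: "x \<in> cimg c"
  have "(det (gram c x) * det (gram c x)) powr (1/4) = (vol_density c x ^ 4) powr (1/4)"
    unfolding vol_density_power4 by (simp add: power2_eq_square)
  also have "\<dots> = vol_density c x"
    using vol_density_pos[OF c x] powr_realpow[of "vol_density c x" 4]
      powr_powr[of "vol_density c x" 4 "1/4"] by simp
  finally show "(det (gram c x) * det (gram c x)) powr (1/4) = vol_density c x" .
qed

text \<open>The density is known to be differentiable; its derivative is found by comparing the derivatives of
  both sides of \<open>vol_density_power4\<close>, using Jacobi's formula on the right.\<close>

lemma has_derivative_vol_density:
  assumes c: "c \<in> A" "x \<in> cimg c" and H: "H ** gram c x = mat 1"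
  shows "(vol_density c has_derivative (\<lambda>v. vol_density c x * trace (H ** dgram c x v) / 2)) (at x)"
proof -
  let ?s = "vol_density c" and ?d = "\<lambda>y. det (gram c y)"
  let ?t = "\<lambda>v. trace (H ** dgram c x v)"
  define s' where "s' = frechet_derivative ?s (at x)"
  have s: "(?s has_derivative s') (at x)"
    unfolding s'_def by (rule smooth_on_has_derivative[OF smooth_vol_density[OF c(1)] c(2)])
  have d: "(?d has_derivative (\<lambda>v. ?d x * ?t v)) (at x)"
    by (rule has_derivative_det[OF has_derivative_gram[OF c] H])
  have "((\<lambda>y. ?s y ^ 4) has_derivative (\<lambda>v. 4 * s' v * ?s x ^ 3)) (at x)"
    using has_derivative_power[OF s, of 4] by (simp add: eval_nat_numeral)
  moreover have "((\<lambda>y. (?d y)\<^sup>2) has_derivative (\<lambda>v. 2 * (?d x * ?t v) * ?d x)) (at x)"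
    using has_derivative_power[OF d, of 2] by simp
  ultimately have eq: "(\<lambda>v. 4 * s' v * ?s x ^ 3) = (\<lambda>v. 2 * (?d x * ?t v) * ?d x)"
    unfolding vol_density_power4 by (rule has_derivative_unique)
  have "s' v = ?s x * ?t v / 2" for v
  proof -
    have "4 * s' v * ?s x ^ 3 = 2 * ?t v * (?d x)\<^sup>2"
      using fun_cong[OF eq, of v] by (simp add: power2_eq_square algebra_simps)
    also have "\<dots> = 2 * ?t v * ?s x * ?s x ^ 3"
      unfolding vol_density_power4[symmetric] by (simp add: eval_nat_numeral)
    finally show ?thesis
      using vol_density_pos[OF c] by simp
  qed
  then have "s' = (\<lambda>v. ?s x * ?t v / 2)" by blast
  with s show ?thesis by simp
qed

text \<open>Summing \<open>inner_nabla_self_chart\<close> over the frame gives \<open>tr (G\<^sup>-\<^sup>1 \<partial>\<^sub>Y G) / 2 + tr (\<partial>Y)\<close>, and the first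
  term is the logarithmic derivative of the density along \<open>Y\<close>.\<close>

lemma divergence_chart:
  assumes c: "c \<in> A" "x \<in> cimg c" and Y: "vector_field A Y"
  shows "vol_density c x * divergence Y (cinv c x) =
    (\<Sum>k\<in>UNIV. frechet_derivative (\<lambda>y. vol_density c y * rep c Y y $ k) (at x) (axis k 1))"
proof -
  define p where "p = cinv c x"
  have pM: "p \<in> topspace M" using cinv_in_M[OF c] p_def by simp
  let ?e = "\<lambda>i. rep c (frame p i) x" and ?\<delta> = "sign_of p" and ?s = "vol_density c"
  note on = frame_orthonormal[OF c p_def]
  define H where "H = inverse_gram ?e ?\<delta>"
  have H: "H ** gram c x = mat 1" unfolding H_def by (rule inverse_gram_inverse[OF on])
  define D where "D = matrix (drep c Y x)"
  note dY = has_derivative_rep[OF Y c]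
  have D: "drep c Y x v = D *v v" for v
    unfolding D_def using has_derivative_linear[OF dY] by (simp add: matrix_works)
  let ?v = "rep c Y x"
  have "divergence Y p = (\<Sum>i\<in>UNIV. ?\<delta> i * ((?e i \<bullet> (dgram c x ?v *v ?e i)) / 2 + ?e i \<bullet> ((gram c x ** D) *v ?e i)))"
    unfolding divergence_def
    using inner_nabla_self_chart[OF c vector_field_frame[OF pM] Y]
    by (simp add: p_def[symmetric] D matrix_vector_mul_assoc)
  also have "\<dots> = (\<Sum>i\<in>UNIV. ?\<delta> i * (?e i \<bullet> (dgram c x ?v *v ?e i))) / 2 + (\<Sum>i\<in>UNIV. ?\<delta> i * (?e i \<bullet> ((gram c x ** D) *v ?e i)))"
    by (simp add: sum.distrib distrib_left sum_divide_distrib)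
  also have "\<dots> = trace (H ** dgram c x ?v) / 2 + trace (H ** (gram c x ** D))"
    unfolding sum_quadratic_form_eq_trace H_def ..
  also have "H ** (gram c x ** D) = D"
    by (simp add: matrix_mul_assoc H)
  finally have div: "divergence Y p = trace (H ** dgram c x ?v) / 2 + trace D" .
  define s' where "s' v = ?s x * trace (H ** dgram c x v) / 2" for v
  have s: "(?s has_derivative s') (at x)"
    unfolding s'_def by (rule has_derivative_vol_density[OF c H])
  have fd: "frechet_derivative (\<lambda>y. ?s y * rep c Y y $ k) (at x) (axis k 1) = ?s x * D $ k $ k + s' (axis k 1) * ?v $ k" for k
  proof -
    have "((\<lambda>y. ?s y * rep c Y y $ k) has_derivative (\<lambda>v. ?s x * drep c Y x v $ k + s' v * ?v $ k)) (at x)"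
      by (intro has_derivative_mult s bounded_linear.has_derivative[OF bounded_linear_vec_nth dY])
    then have "frechet_derivative (\<lambda>y. ?s y * rep c Y y $ k) (at x) = (\<lambda>v. ?s x * drep c Y x v $ k + s' v * ?v $ k)"
      by (rule frechet_derivative_at[symmetric])
    then show ?thesis
      by (simp add: D matrix_vector_mult_basis column_def)
  qed
  have "(\<Sum>k\<in>UNIV. s' (axis k 1) * ?v $ k) = s' ?v"
  proof -
    have "s' (\<Sum>k\<in>UNIV. (?v $ k) *\<^sub>R axis k 1) = (\<Sum>k\<in>UNIV. ?v $ k * s' (axis k 1))"
      using has_derivative_linear[OF s] by (simp add: linear_sum linear_scale)
    then show ?thesis by (simp add: vec_eq_sum_axis[symmetric] mult.commute)
  qed
  moreover have "s' ?v = ?s x * trace (H ** dgram c x ?v) / 2" by (simp add: s'_def)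
  ultimately show ?thesis
    unfolding p_def[symmetric] fd div
    by (simp add: sum.distrib sum_distrib_left[symmetric] trace_def[of D] distrib_left)
qed

lemma divergence_add:
  assumes "vector_field A Y" "vector_field A Z" "vector_field A (vf_add Y Z)" "p \<in> topspace M"
  shows "divergence (vf_add Y Z) p = divergence Y p + divergence Z p"
proof -
  have "vf_inner g (nabla (frame p i) (vf_add Y Z)) (frame p i) p
     = vf_inner g (nabla (frame p i) Y) (frame p i) p + vf_inner g (nabla (frame p i) Z) (frame p i) p" for i
    unfolding nabla_vf_add[OF vector_field_frame[OF assms(4)] assms(1,2)]
    by (intro vf_inner_comb(2) vector_field_nabla vector_field_frame assms)
  then show ?thesis
    by (simp add: divergence_def distrib_left sum.distrib)
qed

text \<open>The frames at different points are unrelated, so that this locality is not visible from the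
  definition; it is visible from the formula in a chart.\<close>

lemma divergence_eq_0:
  assumes Y: "vector_field A Y" and W: "openin M W" "p \<in> W" and 0: "\<And>q. q \<in> W \<Longrightarrow> Y q = (\<lambda>_. 0)"
  shows "divergence Y p = 0"
proof -
  have p: "p \<in> topspace M" using W openin_subset by blast
  obtain c where c: "c \<in> A" "p \<in> cdom c" using ex_chart[OF p] by blast
  define x where "x = cmap c p"
  have x: "x \<in> cimg c" "cinv c x = p" using c by (auto simp: x_def cinv_cmap)
  define T where "T = cmap c ` (cdom c \<inter> W)"
  have T: "open T" "x \<in> T" unfolding T_def using open_cmap_image[OF c(1) W(1)] c W by (auto simp: x_def)
  have "frechet_derivative (\<lambda>y. vol_density c y * rep c Y y $ k) (at x) = (\<lambda>_. 0)" for k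
  proof -
    have "((\<lambda>y. vol_density c y * rep c Y y $ k) has_derivative (\<lambda>_. 0)) (at x)"
      by (rule has_derivative_transform_within_open[of "\<lambda>_. 0" _ _ _ T])
        (use T c 0 in \<open>auto simp: T_def rep_def cinv_cmap\<close>)
    then show ?thesis by (rule frechet_derivative_at[symmetric])
  qed
  then have "vol_density c x * divergence Y p = 0"
    using divergence_chart[OF c(1) x(1) Y] by (simp add: x)
  then show ?thesis using vol_density_pos[OF c(1) x(1)] by simp
qed

end

section \<open>The divergence theorem on a compact manifold\<close>

lemma has_bochner_integral_space_cong:
  assumes "has_bochner_integral \<mu> f I" "\<And>p. p \<in> space \<mu> \<Longrightarrow> f p = h p"
  shows "has_bochner_integral \<mu> h I"
  using assms has_bochner_integral_cong[of \<mu> \<mu> f h I I] by simp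

locale levi_civita_measure_manifold = levi_civita_manifold M A g nabla
  for M :: "'a topology" and A :: "('a, 'n::finite) chart set" and g nabla +
  fixes dg :: "'a measure"
  assumes volume: "volume_measure M A g dg"
begin

lemma space_dg: "space dg = topspace M"
  using volume by (simp add: volume_measure_def)

lemma openin_sets_dg: "openin M W \<Longrightarrow> W \<in> sets dg"
  using volume by (auto simp: volume_measure_def intro: sigma_sets.Basic)

lemma emeasure_dg:
  "c \<in> A \<Longrightarrow> B \<in> sets dg \<Longrightarrow> B \<subseteq> cdom c \<Longrightarrow>
    emeasure dg B = (\<integral>\<^sup>+x\<in>cmap c ` B. ennreal (vol_density c x) \<partial>lborel)"
  using volume by (simp add: volume_measure_def vol_density_def)

lemma cmap_measurable:
  assumes c: "c \<in> A"
  shows "cmap c \<in> borel_measurable (restrict_space dg (cdom c))"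
proof (rule borel_measurableI)
  fix S :: "(real ^ 'n) set" assume "open S"
  then have "{p \<in> cdom c. cmap c p \<in> S} \<in> sets dg"
    by (rule openin_sets_dg[OF openin_cmap_preimage[OF c]])
  moreover have "cmap c -` S \<inter> space (restrict_space dg (cdom c)) = {p \<in> cdom c. cmap c p \<in> S}"
    using cdom_subset[OF c] by (auto simp: space_restrict_space space_dg)
  ultimately show "cmap c -` S \<inter> space (restrict_space dg (cdom c)) \<in> sets (restrict_space dg (cdom c))"
    using openin_sets_dg[OF openin_cdom[OF c]]
    by (auto simp: sets_restrict_space_iff)
qed

lemma vol_density_measurable:
  assumes "c \<in> A"
  shows "(\<lambda>x. indicator (cimg c) x * vol_density c x) \<in> borel_measurable borel"
  using borel_measurable_continuous_on_indicator[OF _ smooth_on_imp_continuous_on[OF smooth_vol_density[OF assms]]]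
    open_cimg[OF assms] by simp

text \<open>On the domain of a chart, integration against the volume element is integration against the density
  on \<open>\<real>\<^sup>n\<close>.\<close>

lemma distr_chart:
  assumes c: "c \<in> A"
  shows "distr (restrict_space dg (cdom c)) borel (cmap c)
    = density lborel (\<lambda>x. ennreal (indicator (cimg c) x * vol_density c x))"
proof (rule measure_eqI)
  fix B assume "B \<in> sets (distr (restrict_space dg (cdom c)) borel (cmap c))"
  then have B: "B \<in> sets borel" by simp
  let ?B = "cmap c -` B \<inter> space (restrict_space dg (cdom c))"
  have sp: "space (restrict_space dg (cdom c)) = cdom c"
    using cdom_subset[OF c] by (auto simp: space_restrict_space space_dg)
  have "?B \<in> sets (restrict_space dg (cdom c))"
    using cmap_measurable[OF c] B by (rule measurable_sets)
  then have B': "?B \<in> sets dg" "?B \<subseteq> cdom c"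
    using openin_sets_dg[OF openin_cdom[OF c]] by (auto simp: sets_restrict_space_iff)
  have img: "cmap c ` ?B = B \<inter> cimg c" unfolding sp by auto
  have "emeasure (distr (restrict_space dg (cdom c)) borel (cmap c)) B = emeasure (restrict_space dg (cdom c)) ?B"
    using cmap_measurable[OF c] B by (rule emeasure_distr)
  also have "\<dots> = emeasure dg ?B"
    using openin_sets_dg[OF openin_cdom[OF c]] B' by (intro emeasure_restrict_space) auto
  also have "\<dots> = (\<integral>\<^sup>+x\<in>B \<inter> cimg c. ennreal (vol_density c x) \<partial>lborel)"
    unfolding emeasure_dg[OF c B'] img ..
  also have "\<dots> = (\<integral>\<^sup>+x\<in>B. ennreal (indicator (cimg c) x * vol_density c x) \<partial>lborel)"
    by (rule nn_integral_cong) (simp split: split_indicator)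
  also have "\<dots> = emeasure (density lborel (\<lambda>x. ennreal (indicator (cimg c) x * vol_density c x))) B"
    using vol_density_measurable[OF c] B by (intro emeasure_density[symmetric]) auto
  finally show "emeasure (distr (restrict_space dg (cdom c)) borel (cmap c)) B = \<dots>" .
qed simp

text \<open>In the chart, the divergence times the density is a sum of partial derivatives of functions that
  extend by zero to continuously differentiable functions on \<open>\<real>\<^sup>n\<close> with support in \<open>K\<close>.\<close>

lemma integral_divergence_chart_eq_0:
  assumes c: "c \<in> A" and K: "compact K" "K \<subseteq> cimg c" and w: "smooth_on (cimg c) w" "\<And>x. x \<notin> K \<Longrightarrow> w x = 0"
  shows "has_bochner_integral dg (divergence (ext_field c K w)) 0"
proof -
  define Y where "Y = ext_field c K w"
  have Y: "vector_field A Y" unfolding Y_def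
    by (rule vector_field_ext_field[OF c open_cimg[OF c] subset_refl K w(1)]) (simp add: w)
  have repY: "rep c Y x = w x" if "x \<in> cimg c" for x
    using ext_field_chart[OF c that, of K w] w(2)[of x] by (simp add: rep_def Y_def)
  have oK: "open (- K)" using K by (simp add: open_Compl compact_imp_closed)
  let ?h = "\<lambda>k y. vol_density c y * w y $ k"
  have h: "smooth_on (cimg c) (?h k)" for k
    by (intro smooth_on_mult smooth_on_vec_nth w smooth_vol_density c open_cimg)
  define \<phi> where "\<phi> k y = (if y \<in> cimg c then ?h k y else 0)" for k y
  define \<phi>' where "\<phi>' k y = (if y \<in> cimg c then frechet_derivative (?h k) (at y) else (\<lambda>_. 0))" for k y
  have d0: "(\<phi> k has_derivative (\<lambda>_. 0)) (at y)" if "y \<notin> K" for k y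
    by (rule has_derivative_transform_within_open[OF _ oK, of "\<lambda>_. 0"])
      (use that w in \<open>auto simp: \<phi>_def\<close>)
  have d: "(\<phi> k has_derivative \<phi>' k y) (at y)" for k y
  proof (cases "y \<in> cimg c")
    case True
    have "(\<phi> k has_derivative frechet_derivative (?h k) (at y)) (at y)"
      by (rule has_derivative_transform_within_open[OF smooth_on_has_derivative[OF h True] open_cimg[OF c] True])
        (simp add: \<phi>_def)
    then show ?thesis using True by (simp add: \<phi>'_def)
  next
    case False
    then show ?thesis using d0[of y k] K by (auto simp: \<phi>'_def)
  qed
  have cont: "continuous_on UNIV (\<lambda>y. \<phi>' k y (axis k 1))" for k
  proof -
    have "continuous_on (cimg c) (\<lambda>y. frechet_derivative (?h k) (at y) (axis k 1))"
      by (rule smooth_on_imp_continuous_on[OF smooth_on_frechet_derivative[OF h]])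
    then have "continuous_on (cimg c) (\<lambda>y. \<phi>' k y (axis k 1))"
      by (rule continuous_on_eq) (simp add: \<phi>'_def)
    moreover have "\<phi>' k y = (\<lambda>_. 0)" if "y \<in> - K" for y
      using has_derivative_unique[OF d d0] that by auto
    then have "continuous_on (- K) (\<lambda>y. \<phi>' k y (axis k 1))"
      by (intro continuous_on_eq[OF continuous_on_const[of _ 0]]) simp
    ultimately have "continuous_on (cimg c \<union> - K) (\<lambda>y. \<phi>' k y (axis k 1))"
      by (intro continuous_on_open_Un open_cimg c oK)
    moreover have "cimg c \<union> - K = UNIV" using K by blast
    ultimately show ?thesis by simp
  qed
  define \<Phi> where "\<Phi> y = (\<Sum>k\<in>UNIV. \<phi>' k y (axis k 1))" for y
  have \<Phi>: "has_bochner_integral lborel \<Phi> 0"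
  proof -
    have "has_bochner_integral lborel \<Phi> (\<Sum>k\<in>(UNIV::'n set). 0)"
      unfolding \<Phi>_def
      by (intro has_bochner_integral_sum integral_directional_derivative_eq_0[where K=K, OF d cont K(1)])
        (simp add: \<phi>_def w)
    then show ?thesis by simp
  qed
  have \<Phi>_div: "\<Phi> y = vol_density c y * divergence Y (cinv c y)" if y: "y \<in> cimg c" for y
  proof -
    have "frechet_derivative (\<lambda>y. vol_density c y * rep c Y y $ k) (at y) = \<phi>' k y" for k
    proof -
      have "((\<lambda>y. vol_density c y * rep c Y y $ k) has_derivative \<phi>' k y) (at y)"
        by (rule has_derivative_transform_within_open[OF d open_cimg[OF c] y])
          (simp add: \<phi>_def repY)
      then show ?thesis by (rule frechet_derivative_at[symmetric])
    qed
    then show ?thesis using divergence_chart[OF c y Y] by (simp add: \<Phi>_def)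
  qed
  have \<Phi>0: "\<Phi> y = 0" if "y \<notin> cimg c" for y
    using that by (simp add: \<Phi>_def \<phi>'_def)
  let ?s = "\<lambda>y. indicator (cimg c) y * vol_density c y"
  \<comment> \<open>the divergence in the chart; outside the chart image the quotient is \<open>0 / 0 = 0\<close>\<close>
  define \<Psi> where "\<Psi> y = \<Phi> y / ?s y" for y
  have [measurable]: "\<Phi> \<in> borel_measurable borel"
    using \<Phi> by (auto simp: has_bochner_integral_iff dest: borel_measurable_integrable)
  have [measurable]: "?s \<in> borel_measurable borel" by (rule vol_density_measurable[OF c])
  have \<Psi>_meas[measurable]: "\<Psi> \<in> borel_measurable borel" unfolding \<Psi>_def by measurable
  have "has_bochner_integral lborel (\<lambda>y. ?s y *\<^sub>R \<Psi> y) 0"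
  proof -
    have "?s y *\<^sub>R \<Psi> y = \<Phi> y" for y
      using vol_density_pos[OF c, of y] \<Phi>0[of y] by (cases "y \<in> cimg c") (auto simp: \<Psi>_def)
    then show ?thesis using \<Phi> by simp
  qed
  then have "has_bochner_integral (density lborel (\<lambda>x. ennreal (?s x))) \<Psi> 0"
    by (intro has_bochner_integral_density)
      (auto simp: less_imp_le[OF vol_density_pos[OF c]] split: split_indicator)
  then have "has_bochner_integral (restrict_space dg (cdom c)) (\<lambda>p. \<Psi> (cmap c p)) 0"
    unfolding distr_chart[OF c, symmetric] using cmap_measurable[OF c] \<Psi>_meas
    by (simp add: has_bochner_integral_iff integrable_distr_eq integral_distr)
  then have *: "has_bochner_integral dg (\<lambda>p. indicator (cdom c) p *\<^sub>R \<Psi> (cmap c p)) 0"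
    using openin_sets_dg[OF openin_cdom[OF c]]
    by (simp add: has_bochner_integral_iff integrable_restrict_space integral_restrict_space)
  have "indicator (cdom c) p *\<^sub>R \<Psi> (cmap c p) = divergence Y p" if p: "p \<in> space dg" for p
  proof (cases "p \<in> cdom c")
    case True
    then show ?thesis
      using \<Phi>_div[of "cmap c p"] vol_density_pos[OF c, of "cmap c p"] by (simp add: \<Psi>_def cinv_cmap[OF c])
  next
    case False
    have "divergence Y p = 0"
      by (rule divergence_eq_0[OF Y, of "topspace M - {p \<in> cdom c. cmap c p \<in> K}"])
        (use closedin_cmap_preimage[OF c K] False p in \<open>auto simp: space_dg Y_def ext_field_def\<close>)
    then show ?thesis using False by simp
  qed
  then show ?thesis
    using has_bochner_integral_space_cong[OF *] by (simp add: Y_def)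
qed

text \<open>The sets on which some cutoff function with compact support in a chart is equal to \<open>1\<close>. They replace
  the members of a partition of unity.\<close>

definition cutoff_domain :: "'a set \<Rightarrow> bool" where
  "cutoff_domain V \<longleftrightarrow> (\<exists>c K \<beta>. c \<in> A \<and> V \<subseteq> cdom c \<and> compact K \<and> K \<subseteq> cimg c \<and> smooth_on UNIV \<beta> \<and>
     (\<forall>y. y \<notin> K \<longrightarrow> \<beta> y = (0::real)) \<and> (\<forall>p\<in>V. \<beta> (cmap c p) = 1))"

lemma cutoff_domain_exists:
  assumes "p \<in> topspace M"
  shows "\<exists>V. openin M V \<and> p \<in> V \<and> cutoff_domain V"
proof -
  obtain c where c: "c \<in> A" "p \<in> cdom c" using ex_chart[OF assms] by blast
  obtain \<beta> :: "real ^ 'n \<Rightarrow> real" and r K where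
    \<beta>: "smooth_on UNIV \<beta>" "r > 0" "compact K" "K \<subseteq> cimg c"
      "ball (cmap c p) r \<subseteq> K" "\<And>y. y \<in> ball (cmap c p) r \<Longrightarrow> \<beta> y = 1" "\<And>y. y \<notin> K \<Longrightarrow> \<beta> y = 0"
    using bump_function_exists[OF open_cimg[OF c(1)] imageI[OF c(2)]] by metis
  let ?V = "{q \<in> cdom c. cmap c q \<in> ball (cmap c p) r}"
  have "cutoff_domain ?V"
    unfolding cutoff_domain_def using c(1) \<beta> by (intro exI[of _ c] exI[of _ K] exI[of _ \<beta>]) simp
  moreover have "openin M ?V" by (rule openin_cmap_preimage[OF c(1) open_ball])
  moreover have "p \<in> ?V" using c \<beta> by simp
  ultimately show ?thesis by blast
qed

text \<open>Induction on the cover: with the cutoff function \<open>\<beta>\<close> of \<open>V\<close>, split \<open>Z\<close> into \<open>\<beta> Z\<close>, which has compact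
  support in a chart, and \<open>(1 - \<beta>) Z\<close>, which vanishes on \<open>V\<close> and wherever \<open>Z\<close> does, so that the
  remaining sets cover the points where it is not zero.\<close>

lemma integral_divergence_cover_eq_0:
  assumes "finite \<V>" "\<And>V. V \<in> \<V> \<Longrightarrow> cutoff_domain V" "vector_field A Z"
    "\<And>p. p \<in> topspace M - \<Union>\<V> \<Longrightarrow> Z p = (\<lambda>_. 0)"
  shows "has_bochner_integral dg (divergence Z) 0"
  using assms
proof (induction \<V> arbitrary: Z)
  case empty
  have "0 = divergence Z p" if "p \<in> space dg" for p
    by (rule divergence_eq_0[OF empty(2), of "topspace M", symmetric]) (use empty that in \<open>auto simp: space_dg\<close>)
  then show ?case
    by (rule has_bochner_integral_space_cong[OF has_bochner_integral_zero])
next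
  case (insert V \<V>)
  from insert.prems(1)[of V] obtain c K and \<beta> :: "real ^ 'n \<Rightarrow> real" where c: "c \<in> A" "V \<subseteq> cdom c"
    and K: "compact K" "K \<subseteq> cimg c"
    and \<beta>: "smooth_on UNIV \<beta>" "\<And>y. y \<notin> K \<Longrightarrow> \<beta> y = 0" "\<And>p. p \<in> V \<Longrightarrow> \<beta> (cmap c p) = 1"
    unfolding cutoff_domain_def by blast
  define w where "w y = \<beta> y *\<^sub>R rep c Z y" for y
  define Y where "Y = ext_field c K w"
  have w: "smooth_on (cimg c) w" "\<And>x. x \<notin> K \<Longrightarrow> w x = 0"
    unfolding w_def
    by (auto intro!: smooth_on_scaleR smooth_rep open_cimg c(1) insert.prems(2) smooth_on_subset[OF \<beta>(1)] simp: \<beta>(2))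
  have Y: "vector_field A Y" unfolding Y_def
    by (rule vector_field_ext_field[OF c(1) open_cimg[OF c(1)] subset_refl K w(1)]) (simp add: w)
  have intY: "has_bochner_integral dg (divergence Y) 0"
    unfolding Y_def by (rule integral_divergence_chart_eq_0[OF c(1) K w])
  have Z': "vector_field A (vf_diff Z Y)" by (rule vector_field_diff[OF insert.prems(2) Y])
  have eq: "Z = vf_add Y (vf_diff Z Y)" by (simp add: vf_add_def vf_diff_def)
  have YV: "Y p = Z p" if "p \<in> V" for p
  proof -
    have "p \<in> cdom c" "\<beta> (cmap c p) = 1" "cmap c p \<in> K" using that c \<beta>(2)[of "cmap c p"] \<beta>(3)[of p] by force+
    then show ?thesis
      using tvec_of_components[OF vector_field_tangent[OF insert.prems(2)] c(1)]
      by (simp add: Y_def ext_field_def w_def rep_def cinv_cmap[OF c(1)])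
  qed
  have Y0: "Y p = (\<lambda>_. 0)" if "Z p = (\<lambda>_. 0)" for p
    using tvec_of_components[OF tangent_zero c(1), of p] that
    by (simp add: Y_def ext_field_def w_def rep_def cinv_cmap[OF c(1)])
  have "vf_diff Z Y p = (\<lambda>_. 0)" if "p \<in> topspace M - \<Union>\<V>" for p
    using that YV[of p] Y0[of p] insert.prems(3)[of p] by (cases "p \<in> V") (auto simp: vf_diff_def)
  then have "has_bochner_integral dg (divergence (vf_diff Z Y)) 0"
    using insert.prems(1) Z' by (intro insert.IH) auto
  with intY have "has_bochner_integral dg (\<lambda>p. divergence Y p + divergence (vf_diff Z Y) p) (0 + 0)"
    by (rule has_bochner_integral_add)
  moreover have "divergence Y p + divergence (vf_diff Z Y) p = divergence Z p" if "p \<in> space dg" for p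
    using divergence_add[OF Y Z' _ that[unfolded space_dg]] eq insert.prems(2) by simp
  ultimately show ?case
    using has_bochner_integral_space_cong[of dg _ "0 + 0" "divergence Z"] by simp
qed

theorem integral_divergence_eq_0:
  assumes "compact_space M" "vector_field A Z"
  shows "has_bochner_integral dg (divergence Z) 0"
proof -
  let ?\<U> = "{V. openin M V \<and> cutoff_domain V}"
  have "topspace M \<subseteq> \<Union>?\<U>" using cutoff_domain_exists by blast
  then obtain \<V> where "finite \<V>" "\<V> \<subseteq> ?\<U>" "topspace M \<subseteq> \<Union>\<V>"
    using assms(1) unfolding compact_space_def compactin_def by (metis (no_types, lifting) mem_Collect_eq)
  then show ?thesis
    by (intro integral_divergence_cover_eq_0[of \<V>] assms) auto
qed

section \<open>The integral inequality for Killing fields\<close>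

lemma ricci_killing:
  assumes U: "killing_field M A g U" and p: "p \<in> topspace M"
  shows "ricci M A g nabla U p = divergence (nabla U U) p
    + (\<Sum>i\<in>UNIV. sign_of p i * vf_inner g (nabla (frame p i) U) (nabla (frame p i) U) p)"
  unfolding ricci_def frame_def[symmetric] Let_def divergence_def
  by (simp add: inner_curvature_killing[OF U vector_field_frame[OF p] p] distrib_left sum.distrib)

end

theorem theorem4p6:
  fixes M :: "'a topology"
    and A :: "('a, 'n::finite) chart set"
    and g :: "('a, 'n) metric"
    and nabla :: "('a, 'n) vfield \<Rightarrow> ('a, 'n) vfield \<Rightarrow> ('a, 'n) vfield"
    and dg :: "'a measure"
    and U :: "('a, 'n) vfield"
  assumes "smooth_manifold M A"
    and "compact_space M"
    and "lorentzian_metric M A g"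
    and "levi_civita M A g nabla"
    and "volume_measure M A g dg"
    and "killing_field M A g U"
    and "timelike M g U"
  shows "0 \<le> (\<integral>p. (ricci M A g nabla U p
                   - 2 / vf_inner g U U p * vf_inner g (nabla U U) (nabla U U) p) \<partial>dg)"
proof -
  interpret levi_civita_measure_manifold M A g nabla dg
    by unfold_locales (use assms in auto)
  let ?h = "\<lambda>p. ricci M A g nabla U p - 2 / vf_inner g U U p * vf_inner g (nabla U U) (nabla U U) p"
  have vU: "vector_field A U" by (rule killing_vector_field[OF assms(6)])
  have div: "has_bochner_integral dg (divergence (nabla U U)) 0"
    by (rule integral_divergence_eq_0[OF assms(2) vector_field_nabla[OF vU vU]])
  have ge: "divergence (nabla U U) p \<le> ?h p" if p: "p \<in> space dg" for p
  proof -
    have pM: "p \<in> topspace M" using p by (simp add: space_dg)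
    obtain c where c: "c \<in> A" "p \<in> cdom c" using ex_chart[OF pM] by blast
    define x where "x = cmap c p"
    have x: "x \<in> cimg c" "p = cinv c x" using c by (auto simp: x_def cinv_cmap)
    show ?thesis
      using sum_inner_nabla_killing_ge[OF assms(6) c(1) x(1) vector_field_frame[OF pM]
          frame_orthonormal[OF c(1) x]] assms(7) pM ricci_killing[OF assms(6) pM]
      by (simp add: x(2)[symmetric] timelike_def)
  qed
  show ?thesis
  proof (cases "integrable dg ?h")
    case True
    have "integral\<^sup>L dg (divergence (nabla U U)) \<le> integral\<^sup>L dg ?h"
      using div ge by (intro integral_mono True) (auto simp: has_bochner_integral_iff)
    then show ?thesis using div by (simp add: has_bochner_integral_iff)
  next
    case False
    then show ?thesis by (simp add: not_integrable_integral_eq)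
  qed
qed

end
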